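(* Let $G$ be a finite group. Let $K$ be a subfield of $\mathbb{C}$ that is closed under complex conjugation, and let $\alpha_K\in\operatorname{Aut}(K)$ be the restriction of complex conjugation to $K$. Let $\mathcal{T}=(U,V,N)$ be a James triple in $G$ of index $k$ and let $f:V\to\mu(K)$ be a group morphism fitting $\mathcal{T}$ with respect to $\alpha_K$. Then $$S^{\mathcal{T},f}_K\cap (S^{\mathcal{T},f}_K)^{\perp}=0,$$ and the $KG$-module $S^{\mathcal{T},f}_K$ is absolutely irreducible.
   Context: Conventions: maps are written on the right, $U^h=h^{-1}Uh$, $wN=\{wn: n\in N\}$, $UV=\{uv:u\in U,v\in V\}$; modules are right modules. $\mu(K)$ is the group of roots of unity in $K$. For $\lambda\in K$ write $\bar\lambda=\lambda\alpha_K$. James triple: for $k\in\mathbb{Z}_{\geq 2}$, a James triple in $G$ of index $k$ is a triple $(U,V,N)$ of subgroups of $G$ such that (J1) $U\cap V\leq N$; (J2) $N$ is a normal subgroup of $V$ with $|V/N|=k$; (J3) for all $h\in G\setminus(UV)$ and all $w\in V$ one has $|wN\cap U^h|=|N\cap U^h|$. Fitting: a group morphism $f:V\to\mu(K)$ fits $(U,V,N)$ with respect to $\alpha_K$ if (1) $\overline{vf}=(vf)^{-1}$ for all $v\in V$; and (2) if $\operatorname{char}(K)$ does not divide $|V/N|$, then $N\leq\ker(f)<V$ (proper subgroup), while if $\operatorname{char}(K)$ divides $|V/N|$, then $N\leq\ker(f)\leq V$. $M_K=K(U\backslash G)$ is the permutation $KG$-module with $K$-basis the right cosets $Ug$, $g\in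 G$, on which $G$ acts by right multiplication. It carries the $G$-invariant sesquilinear form $[-,=]$ ($K$-linear in the first argument, $\alpha_K$-semilinear in the second) with $[Ug,Uh]=1$ if $Ug=Uh$ and $0$ otherwise. $S^{\mathcal{T},f}_K\le M_K$ is the $KG$-submodule generated by $\sum_{v\in V}(vf)\,Uv$, and $(S^{\mathcal{T},f}_K)^\perp=\{x\in M_K:[x,s]=0\text{ for all }s\in S^{\mathcal{T},f}_K\}$. A $KG$-module is absolutely irreducible if it is irreducible and remains irreducible after extending scalars to an algebraic closure of $K$. *)

theory Defs
  imports "HOL-Algebra.Algebraic_Closure_Type"
begin

section \<open>Right modules over group algebras\<close>

text \<open>A right \<open>KG\<close>-module is a \<open>K\<close>-module \<open>M\<close> with a linear right action of \<open>G\<close>;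
  \<open>act x g\<close> stands for \<open>xg\<close>.\<close>

locale kg_module = module K M + G: group G
  for K :: "('k, 'r) ring_scheme" and G :: "('g, 's) monoid_scheme"
    and M :: "('k, 'm, 't) module_scheme" +
  fixes act :: "'m \<Rightarrow> 'g \<Rightarrow> 'm"
  assumes act_closed: "\<lbrakk>x \<in> carrier M; g \<in> carrier G\<rbrakk> \<Longrightarrow> act x g \<in> carrier M"
    and act_add: "\<lbrakk>x \<in> carrier M; y \<in> carrier M; g \<in> carrier G\<rbrakk> \<Longrightarrow>
          act (x \<oplus>\<^bsub>M\<^esub> y) g = act x g \<oplus>\<^bsub>M\<^esub> act y g"
    and act_smult: "\<lbrakk>a \<in> carrier K; x \<in> carrier M; g \<in> carrier G\<rbrakk> \<Longrightarrow>
          act (a \<odot>\<^bsub>M\<^esub> x) g = a \<odot>\<^bsub>M\<^esub> act x g"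
    and act_one: "x \<in> carrier M \<Longrightarrow> act x \<one>\<^bsub>G\<^esub> = x"
    and act_mult: "\<lbrakk>x \<in> carrier M; g \<in> carrier G; h \<in> carrier G\<rbrakk> \<Longrightarrow>
          act x (g \<otimes>\<^bsub>G\<^esub> h) = act (act x g) h"

definition kg_submodule ::
  "('k, 'r) ring_scheme \<Rightarrow> ('g, 's) monoid_scheme \<Rightarrow> ('k, 'm, 't) module_scheme \<Rightarrow>
   ('m \<Rightarrow> 'g \<Rightarrow> 'm) \<Rightarrow> 'm set \<Rightarrow> bool" where
  "kg_submodule K G M act H \<longleftrightarrow>
     submodule H K M \<and> (\<forall>x\<in>H. \<forall>g\<in>carrier G. act x g \<in> H)"

definition kg_span ::
  "('k, 'r) ring_scheme \<Rightarrow> ('g, 's) monoid_scheme \<Rightarrow> ('k, 'm, 't) module_scheme \<Rightarrow>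
   ('m \<Rightarrow> 'g \<Rightarrow> 'm) \<Rightarrow> 'm set \<Rightarrow> 'm set" where
  "kg_span K G M act A = \<Inter>{H. kg_submodule K G M act H \<and> A \<subseteq> H}"

definition irreducible_kg_module ::
  "('k, 'r) ring_scheme \<Rightarrow> ('g, 's) monoid_scheme \<Rightarrow> ('k, 'm, 't) module_scheme \<Rightarrow>
   ('m \<Rightarrow> 'g \<Rightarrow> 'm) \<Rightarrow> bool" where
  "irreducible_kg_module K G M act \<longleftrightarrow>
     kg_module K G M act \<and> carrier M \<noteq> {\<zero>\<^bsub>M\<^esub>} \<and>
     (\<forall>H. kg_submodule K G M act H \<longrightarrow> H = {\<zero>\<^bsub>M\<^esub>} \<or> H = carrier M)"


section \<open>Free modules and permutation modules\<close>

text \<open>The free module on \<open>B\<close> consists of the finitely supported functions \<open>B \<rightarrow> K\<close>.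
  (The \<open>module\<close> record extends the \<open>ring\<close> record, so the multiplicative fields
  have to be filled with something; they play no role.)\<close>

definition free_module :: "('k, 'r) ring_scheme \<Rightarrow> 'x set \<Rightarrow> ('k, 'x \<Rightarrow> 'k) module" where
  "free_module K B =
     \<lparr>carrier = {x \<in> B \<rightarrow>\<^sub>E carrier K. finite {c \<in> B. x c \<noteq> \<zero>\<^bsub>K\<^esub>}},
      monoid.mult = undefined, monoid.one = undefined,
      ring.zero = (\<lambda>c\<in>B. \<zero>\<^bsub>K\<^esub>),
      add = (\<lambda>x y. \<lambda>c\<in>B. x c \<oplus>\<^bsub>K\<^esub> y c),
      module.smult = (\<lambda>a x. \<lambda>c\<in>B. a \<otimes>\<^bsub>K\<^esub> x c)\<rparr>"

definition basis_vec :: "('k, 'r) ring_scheme \<Rightarrow> 'x set \<Rightarrow> 'x \<Rightarrow> ('x \<Rightarrow> 'k)" where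
  "basis_vec K B c = (\<lambda>d\<in>B. if d = c then \<one>\<^bsub>K\<^esub> else \<zero>\<^bsub>K\<^esub>)"

text \<open>Linear extension of a right action \<open>a\<close> of \<open>G\<close> on \<open>B\<close>: the basis vector of \<open>c\<close> is sent
  by \<open>g\<close> to that of \<open>a c g\<close>, whence the inverse below.\<close>

definition free_act ::
  "('g, 's) monoid_scheme \<Rightarrow> 'x set \<Rightarrow> ('x \<Rightarrow> 'g \<Rightarrow> 'x) \<Rightarrow> ('x \<Rightarrow> 'k) \<Rightarrow> 'g \<Rightarrow> ('x \<Rightarrow> 'k)" where
  "free_act G B a x g = (\<lambda>c\<in>B. x (a c (inv\<^bsub>G\<^esub> g)))"

definition perm_module ::
  "('k, 'r) ring_scheme \<Rightarrow> ('g, 's) monoid_scheme \<Rightarrow> 'g set \<Rightarrow> ('k, 'g set \<Rightarrow> 'k) module" where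
  "perm_module K G U = free_module K (rcosets\<^bsub>G\<^esub> U)"

definition perm_act ::
  "('g, 's) monoid_scheme \<Rightarrow> 'g set \<Rightarrow> ('g set \<Rightarrow> 'k) \<Rightarrow> 'g \<Rightarrow> ('g set \<Rightarrow> 'k)" where
  "perm_act G U = free_act G (rcosets\<^bsub>G\<^esub> U) (\<lambda>C g. C #>\<^bsub>G\<^esub> g)"

text \<open>The sesquilinear form for which the cosets are orthonormal (\<open>G\<close> is assumed finite).\<close>

definition perm_form ::
  "('k, 'r) ring_scheme \<Rightarrow> ('g, 's) monoid_scheme \<Rightarrow> 'g set \<Rightarrow> ('k \<Rightarrow> 'k) \<Rightarrow>
   ('g set \<Rightarrow> 'k) \<Rightarrow> ('g set \<Rightarrow> 'k) \<Rightarrow> 'k" where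
  "perm_form K G U \<alpha> x y = (\<Oplus>\<^bsub>K\<^esub>C\<in>rcosets\<^bsub>G\<^esub> U. x C \<otimes>\<^bsub>K\<^esub> \<alpha> (y C))"

definition perm_perp ::
  "('k, 'r) ring_scheme \<Rightarrow> ('g, 's) monoid_scheme \<Rightarrow> 'g set \<Rightarrow> ('k \<Rightarrow> 'k) \<Rightarrow>
   ('g set \<Rightarrow> 'k) set \<Rightarrow> ('g set \<Rightarrow> 'k) set" where
  "perm_perp K G U \<alpha> S =
     {x \<in> carrier (perm_module K G U). \<forall>s\<in>S. perm_form K G U \<alpha> x s = \<zero>\<^bsub>K\<^esub>}"


section \<open>Extension of scalars and absolute irreducibility\<close>

definition submodule_span ::
  "('k, 'r) ring_scheme \<Rightarrow> ('k, 'm, 't) module_scheme \<Rightarrow> 'm set \<Rightarrow> 'm set" where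
  "submodule_span K M A = \<Inter>{H. submodule H K M \<and> A \<subseteq> H}"

text \<open>Quotient modules, following the pattern of \<open>rcoset_mult\<close> in the library: the union
  over representatives is a single coset when \<open>H\<close> is a submodule.\<close>

definition quot_module :: "('k, 'm, 't) module_scheme \<Rightarrow> 'm set \<Rightarrow> ('k, 'm set) module" where
  "quot_module M H =
     \<lparr>carrier = a_rcosets\<^bsub>M\<^esub> H,
      monoid.mult = undefined, monoid.one = undefined,
      ring.zero = H,
      add = set_add M,
      module.smult = (\<lambda>a A. \<Union>x\<in>A. H +>\<^bsub>M\<^esub> (a \<odot>\<^bsub>M\<^esub> x))\<rparr>"

definition quot_act ::
  "('k, 'm, 't) module_scheme \<Rightarrow> 'm set \<Rightarrow> ('m \<Rightarrow> 'g \<Rightarrow> 'm) \<Rightarrow> 'm set \<Rightarrow> 'g \<Rightarrow> 'm set" where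
  "quot_act M H act A g = (\<Union>x\<in>A. H +>\<^bsub>M\<^esub> act x g)"

text \<open>For a field extension \<open>L\<close> of \<open>K\<close>, the tensor product of \<open>L\<close> and \<open>M\<close> over \<open>K\<close> is the free
  \<open>L\<close>-module on the set \<open>M\<close> (the basis vector of \<open>x\<close> representing the tensor of \<open>1\<close> and \<open>x\<close>)
  modulo the relations making \<open>x\<close> enter \<open>K\<close>-linearly.\<close>

definition scalar_ext_relations ::
  "('k, 'u) ring_scheme \<Rightarrow> ('k, 'r) ring_scheme \<Rightarrow> ('k, 'm, 't) module_scheme \<Rightarrow> ('m \<Rightarrow> 'k) set" where
  "scalar_ext_relations L K M =
     (let F = free_module L (carrier M); e = basis_vec L (carrier M)
      in {e (x \<oplus>\<^bsub>M\<^esub> y) \<ominus>\<^bsub>F\<^esub> (e x \<oplus>\<^bsub>F\<^esub> e y) | x y. x \<in> carrier M \<and> y \<in> carrier M}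
       \<union> {e (a \<odot>\<^bsub>M\<^esub> x) \<ominus>\<^bsub>F\<^esub> (a \<odot>\<^bsub>F\<^esub> e x) | a x. a \<in> carrier K \<and> x \<in> carrier M})"

definition scalar_ext ::
  "('k, 'u) ring_scheme \<Rightarrow> ('k, 'r) ring_scheme \<Rightarrow> ('k, 'm, 't) module_scheme \<Rightarrow>
   ('k, ('m \<Rightarrow> 'k) set) module" where
  "scalar_ext L K M =
     (let F = free_module L (carrier M)
      in quot_module F (submodule_span L F (scalar_ext_relations L K M)))"

definition scalar_ext_act ::
  "('k, 'u) ring_scheme \<Rightarrow> ('k, 'r) ring_scheme \<Rightarrow> ('g, 's) monoid_scheme \<Rightarrow>
   ('k, 'm, 't) module_scheme \<Rightarrow> ('m \<Rightarrow> 'g \<Rightarrow> 'm) \<Rightarrow> ('m \<Rightarrow> 'k) set \<Rightarrow> 'g \<Rightarrow> ('m \<Rightarrow> 'k) set" where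
  "scalar_ext_act L K G M act =
     (let F = free_module L (carrier M)
      in quot_act F (submodule_span L F (scalar_ext_relations L K M))
           (free_act G (carrier M) act))"

text \<open>The algebraic closure is sought among the rings on the type that \<open>K\<close> lives in. For a
  subfield \<open>K\<close> of the complex numbers it exists there, and the choice of \<open>L\<close> is
  immaterial since algebraic closures are unique up to isomorphism over \<open>K\<close>.\<close>

definition absolutely_irreducible ::
  "'k ring \<Rightarrow> ('g, 's) monoid_scheme \<Rightarrow> ('k, 'm, 't) module_scheme \<Rightarrow>
   ('m \<Rightarrow> 'g \<Rightarrow> 'm) \<Rightarrow> bool" where
  "absolutely_irreducible K G M act \<longleftrightarrow>
     irreducible_kg_module K G M act \<and>
     (\<exists>L :: 'k ring. algebraic_closure L (carrier K) \<and> L\<lparr>carrier := carrier K\<rparr> = K \<and>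
        irreducible_kg_module L G (scalar_ext L K M) (scalar_ext_act L K G M act))"


section \<open>James triples\<close>

definition conj_set :: "('g, 's) monoid_scheme \<Rightarrow> 'g set \<Rightarrow> 'g \<Rightarrow> 'g set" where
  "conj_set G U h = (inv\<^bsub>G\<^esub> h <#\<^bsub>G\<^esub> U) #>\<^bsub>G\<^esub> h"

locale james_triple = group G
  for G :: "('g, 's) monoid_scheme" (structure) +
  fixes U V N :: "'g set" and k :: nat
  assumes index_ge_2: "2 \<le> k"
    and subgroup_U: "subgroup U G"
    and subgroup_V: "subgroup V G"
    and subgroup_N: "subgroup N G"
    and J1: "U \<inter> V \<subseteq> N"
    and J2_normal: "N \<lhd> G\<lparr>carrier := V\<rparr>"
    and J2_index: "Coset.order (G\<lparr>carrier := V\<rparr> Mod N) = k"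
    and J3: "\<lbrakk>h \<in> carrier G - (U <#> V); w \<in> V\<rbrakk> \<Longrightarrow>
          card ((w <#\<^bsub>G\<^esub> N) \<inter> conj_set G U h) = card (N \<inter> conj_set G U h)"

definition roots_of_unity :: "('k, 'r) ring_scheme \<Rightarrow> ('k, 'r) ring_scheme" where
  "roots_of_unity K = K\<lparr>carrier := {x \<in> carrier K. \<exists>n::nat. n > 0 \<and> x [^]\<^bsub>K\<^esub> n = \<one>\<^bsub>K\<^esub>}\<rparr>"

text \<open>The order of an element of infinite order is \<open>0\<close> in the library, so the additive order
  of \<open>1\<close> is the characteristic.\<close>

definition ring_char :: "('k, 'r) ring_scheme \<Rightarrow> nat" where
  "ring_char K = group.ord (add_monoid K) \<one>\<^bsub>K\<^esub>"

definition fits ::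
  "('k, 'r) ring_scheme \<Rightarrow> ('k \<Rightarrow> 'k) \<Rightarrow> ('g, 's) monoid_scheme \<Rightarrow>
   'g set \<Rightarrow> 'g set \<Rightarrow> ('g \<Rightarrow> 'k) \<Rightarrow> bool" where
  "fits K \<alpha> G V N f \<longleftrightarrow>
     f \<in> hom (G\<lparr>carrier := V\<rparr>) (roots_of_unity K) \<and>
     (\<forall>v\<in>V. \<alpha> (f v) = inv\<^bsub>K\<^esub> (f v)) \<and>
     (let ker = kernel (G\<lparr>carrier := V\<rparr>) (roots_of_unity K) f
      in if ring_char K dvd Coset.order (G\<lparr>carrier := V\<rparr> Mod N)
         then N \<subseteq> ker \<and> ker \<subseteq> V
         else N \<subseteq> ker \<and> ker \<subset> V)"

definition james_submodule ::
  "('k, 'r) ring_scheme \<Rightarrow> ('g, 's) monoid_scheme \<Rightarrow> 'g set \<Rightarrow> 'g set \<Rightarrow> ('g \<Rightarrow> 'k) \<Rightarrow>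
   ('g set \<Rightarrow> 'k) set" where
  "james_submodule K G U V f =
     (let M = perm_module K G U
      in kg_span K G M (perm_act G U)
           {\<Oplus>\<^bsub>M\<^esub>v\<in>V. f v \<odot>\<^bsub>M\<^esub> basis_vec K (rcosets\<^bsub>G\<^esub> U) (U #>\<^bsub>G\<^esub> v)})"

end

theory Submission
  imports Defs
begin

text \<open>Write \<open>M\<close> for the permutation module on the cosets of \<open>U\<close>, \<open>x0 = \<Sum>\<^sub>v (vf) Uv\<close> for the generator of
  the submodule \<open>S\<close>, and let \<open>T\<close> be the action on \<open>M\<close> of the group algebra element
  \<open>e = \<Sum>\<^sub>v (vf) v\<close>, where \<open>v\<close> runs over \<open>V\<close>.

  The James condition (J3) and the non-triviality of \<open>f\<close> force \<open>T\<close> to kill every coset outside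
  \<open>UV\<close>, while it sends \<open>Uv\<close> to \<open>(vf)\<inverse> x0\<close>. In terms of the form,
  \<open>T x = ([x, x0] / \<bar>U \<inter> V\<bar>) x0\<close> for all \<open>x\<close> in \<open>M\<close> (lemma \<open>T_eq\<close>). So \<open>T\<close> maps \<open>M\<close> onto the line of \<open>x0\<close>, and
  a submodule of \<open>S\<close> on which \<open>T\<close> is nonzero contains \<open>x0\<close> and is all of \<open>S\<close>.

  It remains to exclude nonzero submodules killed by \<open>T\<close>. Over \<open>K\<close> they lie in
  \<open>S \<inter> S\<^sup>\<bottom>\<close>, which is zero since the form is positive definite. To treat the algebraic closure \<open>L\<close>
  at the same time, positivity is used once, over \<open>K\<close>, and turned into an identity: the central
  element \<open>\<Sum>\<^sub>g g\<inverse> e g\<close> acts on \<open>S\<close> as a scalar \<open>\<nu>\<close>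
  (lemmas \<open>Z_x0\<close> and \<open>Z_S\<close>), and \<open>\<nu>\<close> is a positive multiple of
  \<open>\<Sum>\<^sub>g \<bar>[x0 g, x0]\<bar>\<^sup>2\<close> (lemma \<open>ip_Z_x0\<close>), hence nonzero. A submodule killed by \<open>T\<close>
  is killed by this element, so by \<open>\<nu>\<close>, and is zero (lemma \<open>irreducible_criterion\<close>).

  All that this criterion asks of \<open>S\<close> are identities between linear maps, a generator, and \<open>x0 \<noteq> 0\<close>. The
  identities pass to the extension of scalars because pure tensors span it, and the generator
  stays nonzero because the inclusion of \<open>S\<close> into the functions on the cosets with values in \<open>L\<close>
  factors through it (lemma \<open>scalar_ext_irreducible\<close>). For \<open>L\<close> serve the complex numbers
  algebraic over \<open>K\<close> (lemma \<open>algebraic_numbers_closure\<close>).\<close>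

section \<open>Linear maps and submodules\<close>

text \<open>The target may be a module over a ring larger than \<open>K\<close>, as it is for the map sending \<open>x\<close>
  to the tensor of \<open>1\<close> and \<open>x\<close>; hence only scalars from \<open>K\<close> are mentioned.\<close>

definition linear_map ::
  "('k, 'r) ring_scheme \<Rightarrow> ('k, 'm, 't) module_scheme \<Rightarrow> ('k, 'n, 'u) module_scheme \<Rightarrow> ('m \<Rightarrow> 'n) \<Rightarrow> bool" where
  "linear_map K M M' \<phi> \<longleftrightarrow> \<phi> \<in> carrier M \<rightarrow> carrier M' \<and>
     (\<forall>x\<in>carrier M. \<forall>y\<in>carrier M. \<phi> (x \<oplus>\<^bsub>M\<^esub> y) = \<phi> x \<oplus>\<^bsub>M'\<^esub> \<phi> y) \<and>
     (\<forall>a\<in>carrier K. \<forall>x\<in>carrier M. \<phi> (a \<odot>\<^bsub>M\<^esub> x) = a \<odot>\<^bsub>M'\<^esub> \<phi> x)"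

lemma linear_mapD:
  assumes "linear_map K M M' \<phi>"
  shows linear_map_closed: "x \<in> carrier M \<Longrightarrow> \<phi> x \<in> carrier M'"
    and linear_map_add: "\<lbrakk>x \<in> carrier M; y \<in> carrier M\<rbrakk> \<Longrightarrow> \<phi> (x \<oplus>\<^bsub>M\<^esub> y) = \<phi> x \<oplus>\<^bsub>M'\<^esub> \<phi> y"
    and linear_map_smult: "\<lbrakk>a \<in> carrier K; x \<in> carrier M\<rbrakk> \<Longrightarrow> \<phi> (a \<odot>\<^bsub>M\<^esub> x) = a \<odot>\<^bsub>M'\<^esub> \<phi> x"
  using assms unfolding linear_map_def by auto

lemma linear_map_group_hom:
  assumes "linear_map K M M' \<phi>" "abelian_group M" "abelian_group M'"
  shows "abelian_group_hom M M' \<phi>"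
proof -
  interpret M: abelian_group M by fact
  interpret M': abelian_group M' by fact
  show ?thesis
    by (rule abelian_group_homI)
      (use assms(1) in \<open>auto simp: group_hom_def group_hom_axioms_def hom_def linear_map_def
        intro: M.a_group M'.a_group M.abelian_group_axioms M'.abelian_group_axioms\<close>)
qed

lemma linear_map_finsum:
  assumes "linear_map K M M' \<phi>" "abelian_group M" "abelian_group M'"
    and "finite I" "h \<in> I \<rightarrow> carrier M"
  shows "\<phi> (\<Oplus>\<^bsub>M\<^esub>i\<in>I. h i) = (\<Oplus>\<^bsub>M'\<^esub>i\<in>I. \<phi> (h i))"
proof -
  interpret abelian_group_hom M M' \<phi>
    by (rule linear_map_group_hom) fact+
  show ?thesis
    using assms(4,5)
  proof (induction I)
    case (insert i I)
    have "h \<in> I \<rightarrow> carrier M" "h i \<in> carrier M" using insert.prems by auto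
    then show ?case using insert
      by (simp add: Pi_iff)
  qed simp
qed

lemma linear_map_comp:
  assumes "linear_map K M M' \<phi>" "linear_map K M' M'' \<psi>"
  shows "linear_map K M M'' (\<lambda>x. \<psi> (\<phi> x))"
  using assms by (auto simp: linear_map_def Pi_iff)

lemma linear_map_sum:
  assumes "module L M'" "carrier K \<subseteq> carrier L" "finite I"
    and "\<And>i. i \<in> I \<Longrightarrow> linear_map K M M' (\<phi> i)"
  shows "linear_map K M M' (\<lambda>x. \<Oplus>\<^bsub>M'\<^esub>i\<in>I. \<phi> i x)"
proof -
  interpret M': module L M' by fact
  have c: "\<phi> i x \<in> carrier M'" if "i \<in> I" "x \<in> carrier M" for i x
    using assms(4) that by (blast intro: linear_map_closed)
  show ?thesis
    unfolding linear_map_def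
  proof (intro conjI ballI funcsetI)
    fix x y assume "x \<in> carrier M" "y \<in> carrier M"
    then show "(\<Oplus>\<^bsub>M'\<^esub>i\<in>I. \<phi> i (x \<oplus>\<^bsub>M\<^esub> y)) = (\<Oplus>\<^bsub>M'\<^esub>i\<in>I. \<phi> i x) \<oplus>\<^bsub>M'\<^esub> (\<Oplus>\<^bsub>M'\<^esub>i\<in>I. \<phi> i y)"
      using c M'.M.finsum_cong'[of I I "\<lambda>i. \<phi> i x \<oplus>\<^bsub>M'\<^esub> \<phi> i y" "\<lambda>i. \<phi> i (x \<oplus>\<^bsub>M\<^esub> y)"]
      by (simp add: linear_map_add[OF assms(4)] M'.M.finsum_addf Pi_iff)
  next
    fix a x assume "a \<in> carrier K" "x \<in> carrier M"
    then show "(\<Oplus>\<^bsub>M'\<^esub>i\<in>I. \<phi> i (a \<odot>\<^bsub>M\<^esub> x)) = a \<odot>\<^bsub>M'\<^esub> (\<Oplus>\<^bsub>M'\<^esub>i\<in>I. \<phi> i x)"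
      using c assms(2,3) by (subst M'.finsum_smult_ldistr)
        (auto intro!: M'.M.finsum_cong' M'.smult_closed simp: linear_map_smult[OF assms(4)])
  qed (use c in \<open>auto intro!: M'.M.finsum_closed\<close>)
qed

lemma (in module) linear_map_scale:
  assumes "a \<in> carrier R"
  shows "linear_map R M M (\<lambda>x. a \<odot>\<^bsub>M\<^esub> x)"
  using assms
  by (auto simp: linear_map_def smult_r_distr smult_assoc1[symmetric] R.m_comm)

lemma (in module) submodule_finsum:
  assumes "submodule H R M" "h \<in> I \<rightarrow> H"
  shows "(\<Oplus>\<^bsub>M\<^esub>i\<in>I. h i) \<in> H"
  using assms(2)
proof (induction I rule: infinite_finite_induct)
  case (infinite I)
  then show ?case
    using subgroup.one_closed[OF submodule.axioms(1)[OF assms(1)]] by simp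
next
  case empty
  then show ?case using subgroup.one_closed[OF submodule.axioms(1)[OF assms(1)]] by simp
next
  case (insert i I)
  then have "h \<in> I \<rightarrow> carrier M" "h i \<in> carrier M" using submoduleE(1)[OF assms(1)] by auto
  with insert show ?case using submoduleE(5)[OF assms(1)] by simp
qed

lemma (in module) finsum_in_submodule:
  assumes "submodule H R M" "finite I" "h \<in> I \<rightarrow> H"
  shows "(\<Oplus>\<^bsub>M\<lparr>carrier := H\<rparr>\<^esub>i\<in>I. h i) = (\<Oplus>\<^bsub>M\<^esub>i\<in>I. h i)"
proof -
  interpret H: module R "M\<lparr>carrier := H\<rparr>"
    using submodule.submodule_is_module[OF assms(1)] module_axioms by blast
  have sub: "H \<subseteq> carrier M" using submoduleE(1)[OF assms(1)] .
  have "linear_map R (M\<lparr>carrier := H\<rparr>) M (\<lambda>x. x)"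
    using sub by (auto simp: linear_map_def)
  from linear_map_finsum[OF this _ _ assms(2), of h] show ?thesis
    using assms(3) H.M.abelian_group_axioms M.abelian_group_axioms by simp
qed

lemma (in module) equalizer_submodule:
  assumes "module R M'" "linear_map R M M' \<phi>" "linear_map R M M' \<psi>"
  shows "submodule {x \<in> carrier M. \<phi> x = \<psi> x} R M"
proof -
  interpret M': module R M' by fact
  interpret p: abelian_group_hom M M' \<phi>
    using linear_map_group_hom assms(2) M.abelian_group_axioms M'.M.abelian_group_axioms by blast
  interpret q: abelian_group_hom M M' \<psi>
    using linear_map_group_hom assms(3) M.abelian_group_axioms M'.M.abelian_group_axioms by blast
  show ?thesis
    by (rule submoduleI) (use linear_map_smult[OF assms(2)] linear_map_smult[OF assms(3)] in auto)
qed

lemma (in module) preimage_submodule: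
  assumes "module L M'" "carrier R \<subseteq> carrier L" "linear_map R M M' \<phi>" "submodule H L M'"
  shows "submodule {x \<in> carrier M. \<phi> x \<in> H} R M"
proof -
  interpret M': module L M' by fact
  interpret p: abelian_group_hom M M' \<phi>
    using linear_map_group_hom assms(3) M.abelian_group_axioms M'.M.abelian_group_axioms by blast
  show ?thesis
    by (rule submoduleI)
      (use assms(2) linear_map_smult[OF assms(3)] M'.submoduleE[OF assms(4)]
        subgroup.one_closed[OF submodule.axioms(1)[OF assms(4)]] in auto)
qed

lemma (in module) submodule_Inter:
  assumes "\<And>H. H \<in> \<H> \<Longrightarrow> submodule H R M" "\<H> \<noteq> {}"
  shows "submodule (\<Inter>\<H>) R M"
proof (rule submoduleI)
  show "\<Inter>\<H> \<subseteq> carrier M" using assms submoduleE(1) by blast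
  show "\<zero>\<^bsub>M\<^esub> \<in> \<Inter>\<H>" using subgroup.one_closed[OF submodule.axioms(1)[OF assms(1)]] by auto
qed (use submoduleE[OF assms(1)] in auto)

lemma (in module) submodule_span_submodule:
  assumes "A \<subseteq> carrier M"
  shows "submodule (submodule_span R M A) R M"
  unfolding submodule_span_def
  by (rule submodule_Inter) (use assms carrier_is_submodule in auto)

lemma submodule_span_incl: "A \<subseteq> submodule_span K M A"
  unfolding submodule_span_def by auto

lemma submodule_span_least:
  assumes "submodule H K M" "A \<subseteq> H"
  shows "submodule_span K M A \<subseteq> H"
  using assms unfolding submodule_span_def by auto

section \<open>Modules over group algebras\<close>

lemma kg_span_incl: "A \<subseteq> kg_span K G M act A"
  unfolding kg_span_def by auto

lemma kg_span_least:
  assumes "kg_submodule K G M act H" "A \<subseteq> H"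
  shows "kg_span K G M act A \<subseteq> H"
  using assms unfolding kg_span_def by auto

context kg_module
begin

lemma linear_map_act: "g \<in> carrier G \<Longrightarrow> linear_map K M M (\<lambda>x. act x g)"
  by (auto simp: linear_map_def act_closed act_add act_smult)

lemma kg_submodule_carrier: "kg_submodule K G M act (carrier M)"
  unfolding kg_submodule_def using carrier_is_submodule act_closed by auto

lemma kg_span_submodule:
  assumes "A \<subseteq> carrier M"
  shows "kg_submodule K G M act (kg_span K G M act A)"
proof -
  have "submodule (kg_span K G M act A) K M"
    unfolding kg_span_def
    by (rule submodule_Inter) (use assms kg_submodule_carrier in \<open>auto simp: kg_submodule_def\<close>)
  then show ?thesis
    unfolding kg_submodule_def kg_span_def by auto
qed

lemma kg_module_submodule:
  assumes "kg_submodule K G M act H"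
  shows "kg_module K G (M\<lparr>carrier := H\<rparr>) act"
proof -
  have H: "submodule H K M" and cl: "\<And>x g. x \<in> H \<Longrightarrow> g \<in> carrier G \<Longrightarrow> act x g \<in> H"
    using assms by (auto simp: kg_submodule_def)
  have "x \<in> carrier M" if "x \<in> H" for x using submoduleE(1)[OF H] that by auto
  then show ?thesis
    using submodule.submodule_is_module[OF H module_axioms] G.group_axioms
    by (auto intro!: kg_module.intro kg_module_axioms.intro
       simp: cl act_add act_smult act_one act_mult)
qed

lemma kg_submodule_of_submodule:
  assumes "kg_submodule K G M act S" "kg_submodule K G (M\<lparr>carrier := S\<rparr>) act H"
  shows "kg_submodule K G M act H"
proof -
  interpret S: kg_module K G "M\<lparr>carrier := S\<rparr>" act
    by (rule kg_module_submodule) fact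
  have S: "submodule S K M" and H: "submodule H K (M\<lparr>carrier := S\<rparr>)"
    using assms by (auto simp: kg_submodule_def)
  have HS: "H \<subseteq> S" using S.submoduleE(1)[OF H] by simp
  have "submodule H K M"
  proof (rule module_incl_imp_submodule)
    show "H \<subseteq> carrier M" using HS submoduleE(1)[OF S] by blast
    show "module K (M\<lparr>carrier := H\<rparr>)"
      using submodule.submodule_is_module[OF H S.module_axioms] by simp
  qed
  then show ?thesis using assms(2) by (simp add: kg_submodule_def)
qed

end

section \<open>An irreducibility criterion\<close>

definition twisted_sum ::
  "('k, 'm, 't) module_scheme \<Rightarrow> ('m \<Rightarrow> 'g \<Rightarrow> 'm) \<Rightarrow> 'g set \<Rightarrow> ('g \<Rightarrow> 'k) \<Rightarrow> 'm \<Rightarrow> 'm" where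
  "twisted_sum M act V f x = (\<Oplus>\<^bsub>M\<^esub>v\<in>V. f v \<odot>\<^bsub>M\<^esub> act x v)"

text \<open>For an element \<open>e\<close> of the group algebra acting as \<open>T\<close>, this is the action of the central
  element \<open>\<Sum>\<^sub>g g\<inverse> e g\<close>.\<close>

definition conj_trace ::
  "('g, 's) monoid_scheme \<Rightarrow> ('k, 'm, 't) module_scheme \<Rightarrow> ('m \<Rightarrow> 'g \<Rightarrow> 'm) \<Rightarrow> ('m \<Rightarrow> 'm) \<Rightarrow> 'm \<Rightarrow> 'm" where
  "conj_trace G M act T x = (\<Oplus>\<^bsub>M\<^esub>g\<in>carrier G. act (T (act x (inv\<^bsub>G\<^esub> g))) g)"

context kg_module
begin

lemma twisted_sum_linear:
  assumes "finite V" "V \<subseteq> carrier G" "f \<in> V \<rightarrow> carrier K"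
  shows "linear_map K M M (twisted_sum M act V f)"
  unfolding twisted_sum_def
proof (rule linear_map_sum[OF module_axioms subset_refl assms(1)])
  fix v assume "v \<in> V"
  then show "linear_map K M M (\<lambda>x. f v \<odot>\<^bsub>M\<^esub> act x v)"
    using linear_map_comp[OF linear_map_act linear_map_scale] assms by blast
qed

lemma conj_trace_linear:
  assumes "finite (carrier G)" "linear_map K M M T"
  shows "linear_map K M M (conj_trace G M act T)"
  unfolding conj_trace_def
proof (rule linear_map_sum[OF module_axioms subset_refl assms(1)])
  fix g assume "g \<in> carrier G"
  then show "linear_map K M M (\<lambda>x. act (T (act x (inv\<^bsub>G\<^esub> g))) g)"
    using linear_map_comp[OF linear_map_comp[OF linear_map_act assms(2)] linear_map_act] by auto
qed

text \<open>Replacing \<open>g\<close> by \<open>gh\<close> in the sum moves \<open>h\<close> from the argument to the result; this is the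
  centrality of \<open>\<Sum>\<^sub>g g\<inverse> e g\<close>, stated for an arbitrary linear \<open>T\<close>.\<close>

lemma conj_trace_act:
  assumes "finite (carrier G)" "linear_map K M M T" "x \<in> carrier M" "h \<in> carrier G"
  shows "conj_trace G M act T (act x h) = act (conj_trace G M act T x) h"
proof -
  have cl: "act (T (act x (inv\<^bsub>G\<^esub> g))) g \<in> carrier M" if "g \<in> carrier G" for g
    using that assms by (auto intro!: act_closed linear_map_closed[OF assms(2)])
  have bij: "bij_betw (\<lambda>g. g \<otimes>\<^bsub>G\<^esub> h) (carrier G) (carrier G)"
    by (rule bij_betw_byWitness[where f' = "\<lambda>g. g \<otimes>\<^bsub>G\<^esub> inv\<^bsub>G\<^esub> h"])
       (use assms(4) in \<open>auto simp: G.m_assoc\<close>)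
  let ?q = "\<lambda>g. act (T (act (act x h) (inv\<^bsub>G\<^esub> g))) g"
  have q: "?q \<in> carrier G \<rightarrow> carrier M"
    using assms by (auto intro!: act_closed linear_map_closed[OF assms(2)])
  have "conj_trace G M act T (act x h) = (\<Oplus>\<^bsub>M\<^esub>g\<in>carrier G. ?q (g \<otimes>\<^bsub>G\<^esub> h))"
    unfolding conj_trace_def
    using M.finsum_reindex[of ?q "\<lambda>g. g \<otimes>\<^bsub>G\<^esub> h" "carrier G"] bij q
    by (simp add: bij_betw_def)
  also have "\<dots> = (\<Oplus>\<^bsub>M\<^esub>g\<in>carrier G. act (act (T (act x (inv\<^bsub>G\<^esub> g))) g) h)"
  proof (rule M.finsum_cong')
    fix g assume g: "g \<in> carrier G"
    have "act (act x h) (inv\<^bsub>G\<^esub> (g \<otimes>\<^bsub>G\<^esub> h)) = act x (inv\<^bsub>G\<^esub> g)"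
      using g assms by (simp add: act_mult[symmetric] G.inv_mult_group G.m_assoc[symmetric])
    then show "?q (g \<otimes>\<^bsub>G\<^esub> h) = act (act (T (act x (inv\<^bsub>G\<^esub> g))) g) h"
      using g assms by (simp add: act_mult linear_map_closed[OF assms(2)] act_closed)
  qed (use cl assms(4) act_closed in auto)
  also have "\<dots> = act (conj_trace G M act T x) h"
    unfolding conj_trace_def
    by (subst linear_map_finsum[OF linear_map_act[OF assms(4)]])
       (use cl assms M.abelian_group_axioms in auto)
  finally show ?thesis .
qed

text \<open>A nonzero submodule \<open>H\<close> that is not killed by the twisted sum \<open>T\<close> contains a nonzero
  multiple of the generator \<open>w\<close>, hence everything. If \<open>T\<close> kills \<open>H\<close>, then so does the
  conjugation trace of \<open>T\<close>, which is a nonzero scalar. The hypotheses are identities between linear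
  maps, so that they survive an extension of scalars.\<close>

lemma irreducible_criterion:
  assumes "field K" "finite (carrier G)" "V \<subseteq> carrier G" "f \<in> V \<rightarrow> carrier K"
    and w: "w \<in> carrier M" "w \<noteq> \<zero>\<^bsub>M\<^esub>"
    and gen: "kg_span K G M act {w} = carrier M"
    and line: "\<And>x. x \<in> carrier M \<Longrightarrow> \<exists>c\<in>carrier K. twisted_sum M act V f x = c \<odot>\<^bsub>M\<^esub> w"
    and nu: "\<nu> \<in> carrier K" "\<nu> \<noteq> \<zero>\<^bsub>K\<^esub>"
    and scal: "\<And>x. x \<in> carrier M \<Longrightarrow> conj_trace G M act (twisted_sum M act V f) x = \<nu> \<odot>\<^bsub>M\<^esub> x"
  shows "irreducible_kg_module K G M act"
  unfolding irreducible_kg_module_def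
proof (intro conjI allI impI)
  interpret K: field K by fact
  let ?T = "twisted_sum M act V f"
  show "kg_module K G M act" by (rule kg_module_axioms)
  show "carrier M \<noteq> {\<zero>\<^bsub>M\<^esub>}" using w by auto
  fix H assume "kg_submodule K G M act H"
  then have H: "submodule H K M" and Hact: "\<And>x g. x \<in> H \<Longrightarrow> g \<in> carrier G \<Longrightarrow> act x g \<in> H"
    and kg: "kg_submodule K G M act H"
    by (auto simp: kg_submodule_def)
  have HM: "H \<subseteq> carrier M" and z: "\<zero>\<^bsub>M\<^esub> \<in> H"
    using submoduleE(1)[OF H] subgroup.one_closed[OF submodule.axioms(1)[OF H]] by auto
  have cancel: "inv\<^bsub>K\<^esub> c \<odot>\<^bsub>M\<^esub> (c \<odot>\<^bsub>M\<^esub> x) = x" "inv\<^bsub>K\<^esub> c \<in> carrier K"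
    if "c \<in> carrier K" "c \<noteq> \<zero>\<^bsub>K\<^esub>" "x \<in> carrier M" for c x
  proof -
    have "c \<in> Units K" using that by (simp add: K.field_Units)
    then show "inv\<^bsub>K\<^esub> c \<odot>\<^bsub>M\<^esub> (c \<odot>\<^bsub>M\<^esub> x) = x" "inv\<^bsub>K\<^esub> c \<in> carrier K"
      using that by (auto simp: smult_assoc1[symmetric])
  qed
  show "H = {\<zero>\<^bsub>M\<^esub>} \<or> H = carrier M"
  proof (cases "\<exists>x\<in>H. ?T x \<noteq> \<zero>\<^bsub>M\<^esub>")
    case True
    then obtain x where x: "x \<in> H" "?T x \<noteq> \<zero>\<^bsub>M\<^esub>" by blast
    obtain c where c: "c \<in> carrier K" "?T x = c \<odot>\<^bsub>M\<^esub> w" using line x HM by blast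
    have "c \<noteq> \<zero>\<^bsub>K\<^esub>" using x c w by auto
    moreover have "?T x \<in> H"
      unfolding twisted_sum_def
      by (rule submodule_finsum[OF H])
         (use x assms(3,4) Hact submoduleE(4)[OF H] in blast)
    ultimately have "w \<in> H"
      using cancel[OF c(1) _ w(1)] submoduleE(4)[OF H, of "inv\<^bsub>K\<^esub> c" "?T x"] c by simp
    then have "carrier M \<subseteq> H" using kg_span_least[OF kg, of "{w}"] gen by auto
    then show ?thesis using HM by blast
  next
    case False
    have "x = \<zero>\<^bsub>M\<^esub>" if x: "x \<in> H" for x
    proof -
      have "conj_trace G M act ?T x = (\<Oplus>\<^bsub>M\<^esub>g\<in>carrier G. \<zero>\<^bsub>M\<^esub>)"
        unfolding conj_trace_def
      proof (rule M.finsum_cong')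
        fix g assume g: "g \<in> carrier G"
        interpret a: abelian_group_hom M M "\<lambda>x. act x g"
          using linear_map_group_hom[OF linear_map_act[OF g]] M.abelian_group_axioms by blast
        have "?T (act x (inv\<^bsub>G\<^esub> g)) = \<zero>\<^bsub>M\<^esub>" using False Hact x g by auto
        then show "act (?T (act x (inv\<^bsub>G\<^esub> g))) g = \<zero>\<^bsub>M\<^esub>" by simp
      qed auto
      then have "\<nu> \<odot>\<^bsub>M\<^esub> x = \<zero>\<^bsub>M\<^esub>" using scal x HM by auto
      then show ?thesis using cancel(1)[OF nu, of x] cancel(2)[OF nu] x HM
        by (metis subsetD smult_r_null)
    qed
    then show ?thesis using z by blast
  qed
qed

end

section \<open>Free modules\<close>

lemma free_module_sel:
  shows free_carrier: "carrier (free_module K B) = {x \<in> B \<rightarrow>\<^sub>E carrier K. finite {c \<in> B. x c \<noteq> \<zero>\<^bsub>K\<^esub>}}"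
    and free_zero: "\<zero>\<^bsub>free_module K B\<^esub> = (\<lambda>c\<in>B. \<zero>\<^bsub>K\<^esub>)"
    and free_add: "x \<oplus>\<^bsub>free_module K B\<^esub> y = (\<lambda>c\<in>B. x c \<oplus>\<^bsub>K\<^esub> y c)"
    and free_smult: "a \<odot>\<^bsub>free_module K B\<^esub> x = (\<lambda>c\<in>B. a \<otimes>\<^bsub>K\<^esub> x c)"
  by (simp_all add: free_module_def)

lemma free_module_apply:
  assumes "x \<in> carrier (free_module K B)" "c \<in> B"
  shows "x c \<in> carrier K"
  using assms by (auto simp: free_carrier)

lemma free_module_eqI:
  assumes "x \<in> carrier (free_module K B)" "y \<in> carrier (free_module K B)"
    and "\<And>c. c \<in> B \<Longrightarrow> x c = y c"
  shows "x = y"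
  using assms by (auto simp: free_carrier intro: PiE_ext)

lemma free_module_module:
  assumes "cring K"
  shows "module K (free_module K B)"
proof -
  interpret K: cring K by fact
  have add: "(\<lambda>c\<in>B. x c \<oplus>\<^bsub>K\<^esub> y c) \<in> carrier (free_module K B)"
    if "x \<in> carrier (free_module K B)" "y \<in> carrier (free_module K B)" for x y
  proof -
    have "{c \<in> B. x c \<oplus>\<^bsub>K\<^esub> y c \<noteq> \<zero>\<^bsub>K\<^esub>} \<subseteq> {c \<in> B. x c \<noteq> \<zero>\<^bsub>K\<^esub>} \<union> {c \<in> B. y c \<noteq> \<zero>\<^bsub>K\<^esub>}" by auto
    then show ?thesis using that
      by (auto simp: free_carrier cong: conj_cong elim: finite_subset)
  qed
  have smult: "(\<lambda>c\<in>B. a \<otimes>\<^bsub>K\<^esub> x c) \<in> carrier (free_module K B)"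
    if "a \<in> carrier K" "x \<in> carrier (free_module K B)" for a x
  proof -
    have "{c \<in> B. a \<otimes>\<^bsub>K\<^esub> x c \<noteq> \<zero>\<^bsub>K\<^esub>} \<subseteq> {c \<in> B. x c \<noteq> \<zero>\<^bsub>K\<^esub>}" using that by auto
    then show ?thesis using that
      by (auto simp: free_carrier cong: conj_cong elim: finite_subset)
  qed
  show ?thesis
  proof (rule moduleI[OF assms])
    show "abelian_group (free_module K B)"
    proof (rule abelian_groupI)
      fix x assume x: "x \<in> carrier (free_module K B)"
      have "\<ominus>\<^bsub>K\<^esub> \<one>\<^bsub>K\<^esub> \<otimes>\<^bsub>K\<^esub> a \<oplus>\<^bsub>K\<^esub> a = \<zero>\<^bsub>K\<^esub>" if "a \<in> carrier K" for a
        using that by (simp add: K.l_minus K.l_neg)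
      then show "\<exists>y\<in>carrier (free_module K B). y \<oplus>\<^bsub>free_module K B\<^esub> x = \<zero>\<^bsub>free_module K B\<^esub>"
        using free_module_apply[OF x] smult[OF _ x, of "\<ominus>\<^bsub>K\<^esub> \<one>\<^bsub>K\<^esub>"]
        by (intro bexI[of _ "\<lambda>c\<in>B. \<ominus>\<^bsub>K\<^esub> \<one>\<^bsub>K\<^esub> \<otimes>\<^bsub>K\<^esub> x c"])
          (auto simp: free_add free_zero cong: restrict_cong)
    qed (auto simp: add free_add free_zero, auto simp: free_carrier K.a_ac Pi_iff PiE_def extensional_def fun_eq_iff restrict_def cong: conj_cong)
  qed (auto simp: add smult free_add free_smult,
      auto simp: free_carrier K.l_distr K.r_distr K.m_assoc Pi_iff PiE_def extensional_def fun_eq_iff)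
qed

lemma free_finsum_apply:
  assumes "cring K" "finite I" "h \<in> I \<rightarrow> carrier (free_module K B)" "c \<in> B"
  shows "(\<Oplus>\<^bsub>free_module K B\<^esub>i\<in>I. h i) c = (\<Oplus>\<^bsub>K\<^esub>i\<in>I. h i c)"
proof -
  interpret K: cring K by fact
  interpret module K "free_module K B" using free_module_module[OF assms(1)] .
  show ?thesis using assms(2,3)
  proof (induction I)
    case (insert i I)
    then have "h \<in> I \<rightarrow> carrier (free_module K B)" "h i \<in> carrier (free_module K B)"
      "(\<lambda>i. h i c) \<in> I \<rightarrow> carrier K" "h i c \<in> carrier K"
      using free_module_apply[OF _ assms(4)] by auto
    then show ?case using insert assms(4) by (simp add: free_add)
  qed (use assms(4) in \<open>simp add: free_zero\<close>)
qed

lemma basis_vec_closed: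
  assumes "cring K"
  shows "basis_vec K B c \<in> carrier (free_module K B)"
proof -
  interpret K: cring K by fact
  have "{d \<in> B. basis_vec K B c d \<noteq> \<zero>\<^bsub>K\<^esub>} \<subseteq> {c}" by (auto simp: basis_vec_def split: if_splits)
  then have "finite {d \<in> B. basis_vec K B c d \<noteq> \<zero>\<^bsub>K\<^esub>}" by (rule finite_subset) simp
  then show ?thesis by (auto simp: free_carrier basis_vec_def)
qed

text \<open>Induction on a finite set containing the support, splitting off one coordinate at a time.\<close>

lemma free_module_generated:
  assumes "cring K" "submodule H K (free_module K B)" "\<And>c. c \<in> B \<Longrightarrow> basis_vec K B c \<in> H"
  shows "H = carrier (free_module K B)"
proof -
  interpret K: cring K by fact
  let ?F = "free_module K B"
  interpret module K ?F using free_module_module[OF assms(1)] .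
  have "x \<in> H" if "finite A" "x \<in> carrier ?F" "{c \<in> B. x c \<noteq> \<zero>\<^bsub>K\<^esub>} \<subseteq> A" for A x
    using that
  proof (induction A arbitrary: x)
    case empty
    have "x = \<zero>\<^bsub>?F\<^esub>"
      by (rule free_module_eqI[OF empty.prems(1) M.zero_closed]) (use empty.prems(2) in \<open>auto simp: free_zero\<close>)
    then show ?case using subgroup.one_closed[OF submodule.axioms(1)[OF assms(2)]] by simp
  next
    case (insert c A)
    show ?case
    proof (cases "c \<in> B")
      case False
      then show ?thesis using insert by blast
    next
      case True
      define y where "y = x(c := \<zero>\<^bsub>K\<^esub>)"
      have yA: "{d \<in> B. y d \<noteq> \<zero>\<^bsub>K\<^esub>} \<subseteq> A"
        using insert.prems(2) by (auto simp: y_def)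
      have "finite {d \<in> B. y d \<noteq> \<zero>\<^bsub>K\<^esub>}"
        by (rule finite_subset[OF yA insert.hyps(1)])
      moreover have "y \<in> B \<rightarrow>\<^sub>E carrier K"
        using insert.prems(1) True by (auto simp: free_carrier y_def PiE_iff extensional_def)
      ultimately have y: "y \<in> carrier ?F" by (simp add: free_carrier)
      have xc: "x c \<in> carrier K" by (rule free_module_apply[OF insert.prems(1) True])
      have eq: "x = x c \<odot>\<^bsub>?F\<^esub> basis_vec K B c \<oplus>\<^bsub>?F\<^esub> y"
      proof (rule free_module_eqI[OF insert.prems(1)])
        show "x c \<odot>\<^bsub>?F\<^esub> basis_vec K B c \<oplus>\<^bsub>?F\<^esub> y \<in> carrier ?F"
          by (intro M.a_closed smult_closed basis_vec_closed[OF assms(1)] xc y)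
        fix d assume d: "d \<in> B"
        have "x d \<in> carrier K" by (rule free_module_apply[OF insert.prems(1) d])
        then show "x d = (x c \<odot>\<^bsub>?F\<^esub> basis_vec K B c \<oplus>\<^bsub>?F\<^esub> y) d"
          using xc d True by (cases "d = c") (simp_all add: free_add free_smult basis_vec_def y_def)
      qed
      have "x c \<odot>\<^bsub>?F\<^esub> basis_vec K B c \<in> H"
        using submoduleE(4)[OF assms(2)] assms(3) True xc by blast
      then have "x c \<odot>\<^bsub>?F\<^esub> basis_vec K B c \<oplus>\<^bsub>?F\<^esub> y \<in> H"
        using submoduleE(5)[OF assms(2)] insert.IH[OF y yA] by blast
      then show ?thesis by (rule ssubst[OF eq])
    qed
  qed
  then show ?thesis using submoduleE(1)[OF assms(2)] by (auto simp: free_carrier)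
qed

lemma free_module_kg_module:
  assumes "cring K" "group G"
    and cl: "\<And>c g. c \<in> B \<Longrightarrow> g \<in> carrier G \<Longrightarrow> a c g \<in> B"
    and one: "\<And>c. c \<in> B \<Longrightarrow> a c \<one>\<^bsub>G\<^esub> = c"
    and mult: "\<And>c g h. c \<in> B \<Longrightarrow> g \<in> carrier G \<Longrightarrow> h \<in> carrier G \<Longrightarrow> a c (g \<otimes>\<^bsub>G\<^esub> h) = a (a c g) h"
  shows "kg_module K G (free_module K B) (free_act G B a)"
proof -
  interpret K: cring K by fact
  interpret G: group G by fact
  interpret module K "free_module K B" using free_module_module[OF assms(1)] .
  have closed: "free_act G B a x g \<in> carrier (free_module K B)"
    if x: "x \<in> carrier (free_module K B)" and g: "g \<in> carrier G" for x g
  proof -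
    have "{c \<in> B. free_act G B a x g c \<noteq> \<zero>\<^bsub>K\<^esub>} \<subseteq> (\<lambda>d. a d g) ` {d \<in> B. x d \<noteq> \<zero>\<^bsub>K\<^esub>}"
    proof
      fix c assume c: "c \<in> {c \<in> B. free_act G B a x g c \<noteq> \<zero>\<^bsub>K\<^esub>}"
      then have "c = a (a c (inv\<^bsub>G\<^esub> g)) g" using g by (simp add: mult[symmetric] one)
      then show "c \<in> (\<lambda>d. a d g) ` {d \<in> B. x d \<noteq> \<zero>\<^bsub>K\<^esub>}" using c g by (auto simp: free_act_def cl)
    qed
    then have "finite {c \<in> B. free_act G B a x g c \<noteq> \<zero>\<^bsub>K\<^esub>}"
      by (rule finite_subset) (use x in \<open>auto simp: free_carrier\<close>)
    then show ?thesis using x g by (auto simp: free_carrier free_act_def cl)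
  qed
  show ?thesis
  proof (intro kg_module.intro kg_module_axioms.intro)
    fix x g h assume x: "x \<in> carrier (free_module K B)" and g: "g \<in> carrier G" "h \<in> carrier G"
    show "free_act G B a x (g \<otimes>\<^bsub>G\<^esub> h) = free_act G B a (free_act G B a x g) h"
      using g x closed by (intro free_module_eqI[of _ K B]) (auto, auto simp: free_act_def cl mult G.inv_mult_group)
  next
    fix x assume "x \<in> carrier (free_module K B)"
    then show "free_act G B a x \<one>\<^bsub>G\<^esub> = x"
      using closed by (intro free_module_eqI[of _ K B]) (auto, auto simp: free_act_def one)
  qed (use closed in \<open>auto simp: module_axioms G.group_axioms, auto simp: free_act_def free_add free_smult cl\<close>)
qed

lemma free_act_basis_vec:
  assumes "group G"
    and cl: "\<And>c g. c \<in> B \<Longrightarrow> g \<in> carrier G \<Longrightarrow> a c g \<in> B"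
    and one: "\<And>c. c \<in> B \<Longrightarrow> a c \<one>\<^bsub>G\<^esub> = c"
    and mult: "\<And>c g h. c \<in> B \<Longrightarrow> g \<in> carrier G \<Longrightarrow> h \<in> carrier G \<Longrightarrow> a c (g \<otimes>\<^bsub>G\<^esub> h) = a (a c g) h"
    and c: "c \<in> B" and g: "g \<in> carrier G"
  shows "free_act G B a (basis_vec K B c) g = basis_vec K B (a c g)"
proof -
  interpret G: group G by fact
  have "a d (inv\<^bsub>G\<^esub> g) = c \<longleftrightarrow> d = a c g" if "d \<in> B" for d
    using that c g by (auto simp: mult[symmetric] one)
  then show ?thesis using g by (auto simp: free_act_def basis_vec_def cl fun_eq_iff)
qed

section \<open>Quotient modules\<close>

context module
begin

lemma submodule_abelian_subgroup:
  assumes "submodule H R M"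
  shows "abelian_subgroup H M"
  using assms by (intro abelian_subgroupI3) (auto intro: additive_subgroupI submodule.axioms(1) M.abelian_group_axioms)

text \<open>The union over representatives in the definitions of the quotient scalar multiplication and of
  the quotient action collapses to a single coset; both are instances of this.\<close>

lemma coset_image:
  assumes H: "submodule H R M" and lin: "linear_map R M M \<phi>" and inv: "\<phi> ` H \<subseteq> H"
    and x: "x \<in> carrier M"
  shows "(\<Union>y\<in>H +>\<^bsub>M\<^esub> x. H +>\<^bsub>M\<^esub> \<phi> y) = H +>\<^bsub>M\<^esub> \<phi> x"
proof -
  interpret H: abelian_subgroup H M using submodule_abelian_subgroup[OF H] .
  have "H +>\<^bsub>M\<^esub> \<phi> y = H +>\<^bsub>M\<^esub> \<phi> x" if y: "y \<in> H +>\<^bsub>M\<^esub> x" for y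
  proof -
    obtain h where h: "h \<in> H" "y = h \<oplus>\<^bsub>M\<^esub> x" using y by (auto simp: a_r_coset_def')
    then have "\<phi> y = \<phi> h \<oplus>\<^bsub>M\<^esub> \<phi> x"
      using linear_map_add[OF lin] x H.a_subset by blast
    then have "\<phi> y \<in> H +>\<^bsub>M\<^esub> \<phi> x" using h inv by (auto simp: a_r_coset_def')
    then show ?thesis using H.a_repr_independence' linear_map_closed[OF lin x] by blast
  qed
  moreover have "x \<in> H +>\<^bsub>M\<^esub> x" using x by (rule H.a_rcos_self)
  ultimately show ?thesis by blast
qed

lemma quot_module_sel:
  shows quot_carrier: "carrier (quot_module M H) = a_rcosets\<^bsub>M\<^esub> H"
    and quot_zero: "\<zero>\<^bsub>quot_module M H\<^esub> = H"
  by (simp_all add: quot_module_def)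

context
  fixes H assumes H: "submodule H R M"
begin

interpretation H: abelian_subgroup H M using submodule_abelian_subgroup[OF H] .

lemma quot_carrierE:
  assumes "A \<in> carrier (quot_module M H)"
  obtains x where "x \<in> carrier M" "A = H +>\<^bsub>M\<^esub> x"
  using assms by (auto simp: quot_carrier A_RCOSETS_def')

lemma quot_closed: "x \<in> carrier M \<Longrightarrow> H +>\<^bsub>M\<^esub> x \<in> carrier (quot_module M H)"
  by (auto simp: quot_carrier A_RCOSETS_def')

lemma quot_add:
  "\<lbrakk>x \<in> carrier M; y \<in> carrier M\<rbrakk> \<Longrightarrow>
     (H +>\<^bsub>M\<^esub> x) \<oplus>\<^bsub>quot_module M H\<^esub> (H +>\<^bsub>M\<^esub> y) = H +>\<^bsub>M\<^esub> (x \<oplus>\<^bsub>M\<^esub> y)"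
  by (simp add: quot_module_def H.a_rcos_sum)

lemma quot_smult:
  "\<lbrakk>a \<in> carrier R; x \<in> carrier M\<rbrakk> \<Longrightarrow>
     a \<odot>\<^bsub>quot_module M H\<^esub> (H +>\<^bsub>M\<^esub> x) = H +>\<^bsub>M\<^esub> (a \<odot>\<^bsub>M\<^esub> x)"
  using coset_image[OF H linear_map_scale, of a x] submoduleE(4)[OF H]
  by (simp add: quot_module_def image_subset_iff)

lemma quot_zero': "\<zero>\<^bsub>quot_module M H\<^esub> = H +>\<^bsub>M\<^esub> \<zero>\<^bsub>M\<^esub>"
  using H.a_subset by (simp add: quot_zero)

lemma quot_module_module: "module R (quot_module M H)"
proof (rule moduleI)
  show "abelian_group (quot_module M H)"
  proof (rule abelian_groupI)
    fix A assume "A \<in> carrier (quot_module M H)"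
    then obtain x where "x \<in> carrier M" "A = H +>\<^bsub>M\<^esub> x" by (rule quot_carrierE)
    then show "\<exists>B\<in>carrier (quot_module M H). B \<oplus>\<^bsub>quot_module M H\<^esub> A = \<zero>\<^bsub>quot_module M H\<^esub>"
      by (intro bexI[of _ "H +>\<^bsub>M\<^esub> (\<ominus>\<^bsub>M\<^esub> x)"])
         (auto simp: quot_add quot_zero' quot_closed M.l_neg)
  qed (auto elim!: quot_carrierE simp: quot_add quot_closed quot_zero' M.a_ac)
qed (auto elim!: quot_carrierE
      simp: quot_add quot_closed quot_smult smult_l_distr smult_r_distr smult_assoc1 R.cring_axioms)

lemma quot_linear: "linear_map R M (quot_module M H) (\<lambda>x. H +>\<^bsub>M\<^esub> x)"
  by (auto simp: linear_map_def quot_closed quot_add quot_smult)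

lemma quot_eq:
  assumes "x \<in> carrier M" "y \<in> carrier M" "x \<ominus>\<^bsub>M\<^esub> y \<in> H"
  shows "H +>\<^bsub>M\<^esub> x = H +>\<^bsub>M\<^esub> y"
proof -
  have "x = (x \<ominus>\<^bsub>M\<^esub> y) \<oplus>\<^bsub>M\<^esub> y"
    using assms by (simp add: M.minus_eq M.a_assoc M.l_neg)
  then have "x \<in> H +>\<^bsub>M\<^esub> y" using assms(3) by (auto simp: a_r_coset_def')
  then show ?thesis using H.a_repr_independence' assms(2) by metis
qed

end

end

lemma (in kg_module) quot_act_coset:
  assumes "kg_submodule K G M act H" "x \<in> carrier M" "g \<in> carrier G"
  shows "quot_act M H act (H +>\<^bsub>M\<^esub> x) g = H +>\<^bsub>M\<^esub> act x g"
  using coset_image[OF _ linear_map_act[OF assms(3)] _ assms(2), of H] assms(1,3)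
  by (auto simp: quot_act_def kg_submodule_def)

lemma (in kg_module) quot_kg_module:
  assumes "kg_submodule K G M act H"
  shows "kg_module K G (quot_module M H) (quot_act M H act)"
proof -
  have H: "submodule H K M" using assms by (simp add: kg_submodule_def)
  show ?thesis
    by (intro kg_module.intro kg_module_axioms.intro quot_module_module[OF H] G.group_axioms)
      (auto elim!: quot_carrierE[OF H] simp: quot_act_coset[OF assms] quot_closed[OF H]
        quot_add[OF H] quot_smult[OF H] act_closed act_add act_smult act_one act_mult)
qed

section \<open>Transport along linear maps\<close>

lemma twisted_sum_natural:
  assumes "abelian_group M" "abelian_group M'" "linear_map K M M' \<iota>"
    and "\<And>x g. x \<in> carrier M \<Longrightarrow> g \<in> carrier G \<Longrightarrow> act x g \<in> carrier M"
    and "\<And>x g. x \<in> carrier M \<Longrightarrow> g \<in> carrier G \<Longrightarrow> \<iota> (act x g) = act' (\<iota> x) g"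
    and "\<And>a x. a \<in> carrier K \<Longrightarrow> x \<in> carrier M \<Longrightarrow> a \<odot>\<^bsub>M\<^esub> x \<in> carrier M"
    and "finite V" "V \<subseteq> carrier G" "f \<in> V \<rightarrow> carrier K" "x \<in> carrier M"
  shows "\<iota> (twisted_sum M act V f x) = twisted_sum M' act' V f (\<iota> x)"
proof -
  interpret M: abelian_group M by fact
  interpret M': abelian_group M' by fact
  have c: "f v \<odot>\<^bsub>M\<^esub> act x v \<in> carrier M" "\<iota> (f v \<odot>\<^bsub>M\<^esub> act x v) = f v \<odot>\<^bsub>M'\<^esub> act' (\<iota> x) v" if "v \<in> V" for v
  proof -
    have "v \<in> carrier G" "f v \<in> carrier K" using that assms(8,9) by auto
    then show "f v \<odot>\<^bsub>M\<^esub> act x v \<in> carrier M" "\<iota> (f v \<odot>\<^bsub>M\<^esub> act x v) = f v \<odot>\<^bsub>M'\<^esub> act' (\<iota> x) v"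
      using assms(4-6,10) linear_map_smult[OF assms(3)] by auto
  qed
  have "\<iota> (twisted_sum M act V f x) = (\<Oplus>\<^bsub>M'\<^esub>v\<in>V. \<iota> (f v \<odot>\<^bsub>M\<^esub> act x v))"
    unfolding twisted_sum_def
    by (rule linear_map_finsum[OF assms(3,1,2,7)]) (use c in auto)
  also have "\<dots> = twisted_sum M' act' V f (\<iota> x)"
    unfolding twisted_sum_def
    by (rule M'.finsum_cong') (use c linear_map_closed[OF assms(3)] in \<open>auto simp flip: c(2)\<close>)
  finally show ?thesis .
qed

lemma conj_trace_natural:
  assumes "group G" "abelian_group M" "abelian_group M'" "linear_map K M M' \<iota>"
    and act: "\<And>x g. x \<in> carrier M \<Longrightarrow> g \<in> carrier G \<Longrightarrow> act x g \<in> carrier M"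
    and nat: "\<And>x g. x \<in> carrier M \<Longrightarrow> g \<in> carrier G \<Longrightarrow> \<iota> (act x g) = act' (\<iota> x) g"
    and T: "\<And>x. x \<in> carrier M \<Longrightarrow> T x \<in> carrier M" "\<And>x. x \<in> carrier M \<Longrightarrow> \<iota> (T x) = T' (\<iota> x)"
    and "finite (carrier G)" "x \<in> carrier M"
  shows "\<iota> (conj_trace G M act T x) = conj_trace G M' act' T' (\<iota> x)"
proof -
  interpret G: group G by fact
  interpret M: abelian_group M by fact
  interpret M': abelian_group M' by fact
  have c: "act (T (act x (inv\<^bsub>G\<^esub> g))) g \<in> carrier M"
    "\<iota> (act (T (act x (inv\<^bsub>G\<^esub> g))) g) = act' (T' (act' (\<iota> x) (inv\<^bsub>G\<^esub> g))) g" if "g \<in> carrier G" for g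
    using that assms(10) act T by (auto simp flip: nat T(2))
  have "\<iota> (conj_trace G M act T x) = (\<Oplus>\<^bsub>M'\<^esub>g\<in>carrier G. \<iota> (act (T (act x (inv\<^bsub>G\<^esub> g))) g))"
    unfolding conj_trace_def
    by (rule linear_map_finsum[OF assms(4,2,3,9)]) (use c in auto)
  also have "\<dots> = conj_trace G M' act' T' (\<iota> x)"
    unfolding conj_trace_def
    by (rule M'.finsum_cong') (use c linear_map_closed[OF assms(4)] in \<open>auto simp flip: c(2)\<close>)
  finally show ?thesis .
qed

lemma (in module) line_submodule:
  assumes "w \<in> carrier M"
  shows "submodule {c \<odot>\<^bsub>M\<^esub> w | c. c \<in> carrier R} R M"
proof (rule submoduleI)
  show "\<zero>\<^bsub>M\<^esub> \<in> {c \<odot>\<^bsub>M\<^esub> w | c. c \<in> carrier R}"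
    using assms by (auto intro!: exI[of _ "\<zero>"])
next
  fix x assume "x \<in> {c \<odot>\<^bsub>M\<^esub> w | c. c \<in> carrier R}"
  then show "\<ominus>\<^bsub>M\<^esub> x \<in> {c \<odot>\<^bsub>M\<^esub> w | c. c \<in> carrier R}"
    using assms by (force simp: smult_l_minus[symmetric])
next
  fix x y assume "x \<in> {c \<odot>\<^bsub>M\<^esub> w | c. c \<in> carrier R}" "y \<in> {c \<odot>\<^bsub>M\<^esub> w | c. c \<in> carrier R}"
  then show "x \<oplus>\<^bsub>M\<^esub> y \<in> {c \<odot>\<^bsub>M\<^esub> w | c. c \<in> carrier R}"
    using assms by (force simp: smult_l_distr[symmetric])
next
  fix a x assume "a \<in> carrier R" "x \<in> {c \<odot>\<^bsub>M\<^esub> w | c. c \<in> carrier R}"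
  then show "a \<odot>\<^bsub>M\<^esub> x \<in> {c \<odot>\<^bsub>M\<^esub> w | c. c \<in> carrier R}"
    using assms by (force simp: smult_assoc1[symmetric])
qed (use assms in auto)

text \<open>The universal property. The defining sum over the support may be taken over any larger finite
  set, which makes additivity a statement about one common index set.\<close>

lemma free_module_extend:
  assumes "module L M'" "\<phi> \<in> B \<rightarrow> carrier M'"
  obtains \<Phi> where "linear_map L (free_module L B) M' \<Phi>"
    and "\<And>b. b \<in> B \<Longrightarrow> \<Phi> (basis_vec L B b) = \<phi> b"
proof
  interpret M': module L M' by fact
  let ?F = "free_module L B"
  interpret F: module L ?F using free_module_module[OF M'.R.cring_axioms] .
  define supp where "supp y = {b \<in> B. y b \<noteq> \<zero>\<^bsub>L\<^esub>}" for y
  define \<Phi> where "\<Phi> y = (\<Oplus>\<^bsub>M'\<^esub>b\<in>supp y. y b \<odot>\<^bsub>M'\<^esub> \<phi> b)" for y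
  have fin: "finite (supp y)" if "y \<in> carrier ?F" for y
    using that by (auto simp: free_carrier supp_def)
  have cl: "y b \<odot>\<^bsub>M'\<^esub> \<phi> b \<in> carrier M'" if "y \<in> carrier ?F" "b \<in> B" for y b
    using that assms(2) free_module_apply by fastforce
  have \<Phi>: "\<Phi> y = (\<Oplus>\<^bsub>M'\<^esub>b\<in>A. y b \<odot>\<^bsub>M'\<^esub> \<phi> b)"
    if "y \<in> carrier ?F" "finite A" "supp y \<subseteq> A" "A \<subseteq> B" for y A
    unfolding \<Phi>_def
  proof (rule M'.M.add.finprod_mono_neutral_cong_left)
    fix b assume "b \<in> A - supp y"
    then have "b \<in> B" "y b = \<zero>\<^bsub>L\<^esub>" using that by (auto simp: supp_def)
    moreover have "\<phi> b \<in> carrier M'" using assms(2) \<open>b \<in> B\<close> by blast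
    ultimately show "y b \<odot>\<^bsub>M'\<^esub> \<phi> b = \<zero>\<^bsub>M'\<^esub>" by simp
  qed (use that cl in auto)
  show "linear_map L ?F M' \<Phi>"
    unfolding linear_map_def
  proof (intro conjI ballI funcsetI)
    fix y assume "y \<in> carrier ?F"
    then show "\<Phi> y \<in> carrier M'"
      unfolding \<Phi>_def by (intro M'.M.finsum_closed) (auto simp: supp_def intro: cl)
  next
    fix x y assume x: "x \<in> carrier ?F" and y: "y \<in> carrier ?F"
    let ?A = "supp x \<union> supp y"
    have A: "finite ?A" "?A \<subseteq> B" using fin x y by (auto simp: supp_def)
    have "supp (x \<oplus>\<^bsub>?F\<^esub> y) \<subseteq> ?A" by (auto simp: supp_def free_add)
    then have "\<Phi> (x \<oplus>\<^bsub>?F\<^esub> y) = (\<Oplus>\<^bsub>M'\<^esub>b\<in>?A. (x \<oplus>\<^bsub>?F\<^esub> y) b \<odot>\<^bsub>M'\<^esub> \<phi> b)"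
      using A x y by (intro \<Phi>) auto
    also have "\<dots> = (\<Oplus>\<^bsub>M'\<^esub>b\<in>?A. x b \<odot>\<^bsub>M'\<^esub> \<phi> b \<oplus>\<^bsub>M'\<^esub> y b \<odot>\<^bsub>M'\<^esub> \<phi> b)"
    proof (rule M'.M.finsum_cong')
      fix b assume "b \<in> ?A"
      then have b: "b \<in> B" using A by blast
      then have "\<phi> b \<in> carrier M'" using assms(2) by blast
      then show "(x \<oplus>\<^bsub>?F\<^esub> y) b \<odot>\<^bsub>M'\<^esub> \<phi> b = x b \<odot>\<^bsub>M'\<^esub> \<phi> b \<oplus>\<^bsub>M'\<^esub> y b \<odot>\<^bsub>M'\<^esub> \<phi> b"
        using b x y by (simp add: free_add M'.smult_l_distr free_module_apply)
    qed (use A x y cl in auto)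
    also have "\<dots> = (\<Oplus>\<^bsub>M'\<^esub>b\<in>?A. x b \<odot>\<^bsub>M'\<^esub> \<phi> b) \<oplus>\<^bsub>M'\<^esub> (\<Oplus>\<^bsub>M'\<^esub>b\<in>?A. y b \<odot>\<^bsub>M'\<^esub> \<phi> b)"
      using A x y cl by (intro M'.M.finsum_addf) auto
    also have "\<dots> = \<Phi> x \<oplus>\<^bsub>M'\<^esub> \<Phi> y"
      using A x y \<Phi>[of x ?A] \<Phi>[of y ?A] by simp
    finally show "\<Phi> (x \<oplus>\<^bsub>?F\<^esub> y) = \<Phi> x \<oplus>\<^bsub>M'\<^esub> \<Phi> y" .
  next
    fix a x assume a: "a \<in> carrier L" and x: "x \<in> carrier ?F"
    have A: "finite (supp x)" "supp x \<subseteq> B" using fin x by (auto simp: supp_def)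
    have "supp (a \<odot>\<^bsub>?F\<^esub> x) \<subseteq> supp x" using a by (auto simp: supp_def free_smult)
    then have "\<Phi> (a \<odot>\<^bsub>?F\<^esub> x) = (\<Oplus>\<^bsub>M'\<^esub>b\<in>supp x. (a \<odot>\<^bsub>?F\<^esub> x) b \<odot>\<^bsub>M'\<^esub> \<phi> b)"
      using A a x by (intro \<Phi>) auto
    also have "\<dots> = (\<Oplus>\<^bsub>M'\<^esub>b\<in>supp x. a \<odot>\<^bsub>M'\<^esub> (x b \<odot>\<^bsub>M'\<^esub> \<phi> b))"
    proof (rule M'.M.finsum_cong')
      fix b assume "b \<in> supp x"
      then have b: "b \<in> B" using A by blast
      then have "\<phi> b \<in> carrier M'" using assms(2) by blast
      then show "(a \<odot>\<^bsub>?F\<^esub> x) b \<odot>\<^bsub>M'\<^esub> \<phi> b = a \<odot>\<^bsub>M'\<^esub> (x b \<odot>\<^bsub>M'\<^esub> \<phi> b)"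
        using b x a by (simp add: free_smult M'.smult_assoc1 free_module_apply)
    qed (use A x a cl in auto)
    also have "\<dots> = a \<odot>\<^bsub>M'\<^esub> \<Phi> x"
      unfolding \<Phi>_def using A x a cl by (intro M'.finsum_smult_ldistr[symmetric]) auto
    finally show "\<Phi> (a \<odot>\<^bsub>?F\<^esub> x) = a \<odot>\<^bsub>M'\<^esub> \<Phi> x" .
  qed
  fix b assume b: "b \<in> B"
  then have \<phi>: "\<phi> b \<in> carrier M'" using assms(2) by blast
  have "\<Phi> (basis_vec L B b) = (\<Oplus>\<^bsub>M'\<^esub>c\<in>{b}. basis_vec L B b c \<odot>\<^bsub>M'\<^esub> \<phi> c)"
    using b basis_vec_closed[OF M'.R.cring_axioms]
    by (intro \<Phi>) (auto simp: supp_def basis_vec_def split: if_splits)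
  also have "\<dots> = \<phi> b"
    using b \<phi> by (simp add: basis_vec_def)
  finally show "\<Phi> (basis_vec L B b) = \<phi> b" .
qed

section \<open>Extension of scalars\<close>

text \<open>The tensor of \<open>1\<close> and \<open>x\<close>.\<close>

definition pure_tensor ::
  "('k, 'u) ring_scheme \<Rightarrow> ('k, 'r) ring_scheme \<Rightarrow> ('k, 'm, 't) module_scheme \<Rightarrow> 'm \<Rightarrow> ('m \<Rightarrow> 'k) set" where
  "pure_tensor L K M x =
     submodule_span L (free_module L (carrier M)) (scalar_ext_relations L K M)
       +>\<^bsub>free_module L (carrier M)\<^esub> basis_vec L (carrier M) x"

context kg_module
begin

context
  fixes L :: "('k, 'u) ring_scheme"
  assumes L: "cring L" and KL: "carrier K \<subseteq> carrier L"
begin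

abbreviation "FL \<equiv> free_module L (carrier M)"
abbreviation "eL \<equiv> basis_vec L (carrier M)"
abbreviation "RL \<equiv> submodule_span L FL (scalar_ext_relations L K M)"
abbreviation "WL \<equiv> scalar_ext L K M"

interpretation FL: kg_module L G FL "free_act G (carrier M) act"
  by (rule free_module_kg_module[OF L G.group_axioms act_closed act_one act_mult])

lemma eL_closed: "eL x \<in> carrier FL"
  by (rule basis_vec_closed[OF L])

lemma relations_cases:
  assumes "r \<in> scalar_ext_relations L K M"
  obtains (add) x y where "x \<in> carrier M" "y \<in> carrier M"
      "r = eL (x \<oplus>\<^bsub>M\<^esub> y) \<ominus>\<^bsub>FL\<^esub> (eL x \<oplus>\<^bsub>FL\<^esub> eL y)"
    | (smult) a x where "a \<in> carrier K" "x \<in> carrier M"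
      "r = eL (a \<odot>\<^bsub>M\<^esub> x) \<ominus>\<^bsub>FL\<^esub> (a \<odot>\<^bsub>FL\<^esub> eL x)"
  using assms unfolding scalar_ext_relations_def Let_def by blast

lemma add_relation:
  assumes "x \<in> carrier M" "y \<in> carrier M"
  shows "eL (x \<oplus>\<^bsub>M\<^esub> y) \<ominus>\<^bsub>FL\<^esub> (eL x \<oplus>\<^bsub>FL\<^esub> eL y) \<in> scalar_ext_relations L K M"
  using assms unfolding scalar_ext_relations_def Let_def by blast

lemma smult_relation:
  assumes "a \<in> carrier K" "x \<in> carrier M"
  shows "eL (a \<odot>\<^bsub>M\<^esub> x) \<ominus>\<^bsub>FL\<^esub> (a \<odot>\<^bsub>FL\<^esub> eL x) \<in> scalar_ext_relations L K M"
  using assms unfolding scalar_ext_relations_def Let_def by blast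

lemma relations_closed: "scalar_ext_relations L K M \<subseteq> carrier FL"
  using eL_closed KL by (auto elim!: relations_cases intro!: FL.M.minus_closed)

lemma relations_in_RL: "scalar_ext_relations L K M \<subseteq> RL"
  by (rule submodule_span_incl)

lemma RL_submodule: "submodule RL L FL"
  by (rule FL.submodule_span_submodule[OF relations_closed])

lemma RL_kg_submodule: "kg_submodule L G FL (free_act G (carrier M) act) RL"
  unfolding kg_submodule_def
proof (intro conjI ballI RL_submodule)
  fix r g assume r: "r \<in> RL" and g: "g \<in> carrier G"
  let ?a = "\<lambda>x. free_act G (carrier M) act x g"
  have e: "?a (eL x) = eL (act x g)" if "x \<in> carrier M" for x
    by (rule free_act_basis_vec[OF G.group_axioms act_closed act_one act_mult that g])
  have lin: "linear_map L FL FL ?a" by (rule FL.linear_map_act[OF g])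
  interpret a: abelian_group_hom FL FL ?a
    by (rule linear_map_group_hom[OF lin FL.M.abelian_group_axioms FL.M.abelian_group_axioms])
  have "scalar_ext_relations L K M \<subseteq> {x \<in> carrier FL. ?a x \<in> RL}"
  proof
    fix s assume s: "s \<in> scalar_ext_relations L K M"
    then have "?a s \<in> scalar_ext_relations L K M"
    proof (cases rule: relations_cases)
      case (add x y)
      have "?a s = eL (act (x \<oplus>\<^bsub>M\<^esub> y) g) \<ominus>\<^bsub>FL\<^esub> (eL (act x g) \<oplus>\<^bsub>FL\<^esub> eL (act y g))"
        unfolding add(3) using add(1,2)
        by (simp only: FL.M.minus_eq a.hom_add a.hom_a_inv eL_closed FL.M.a_closed FL.M.a_inv_closed e M.a_closed)
      then show ?thesis using add_relation[of "act x g" "act y g"] add(1,2) act_closed g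
        by (simp only: act_add)
    next
      case (smult b x)
      have b: "b \<in> carrier L" using smult KL by blast
      have "?a s = eL (act (b \<odot>\<^bsub>M\<^esub> x) g) \<ominus>\<^bsub>FL\<^esub> (b \<odot>\<^bsub>FL\<^esub> eL (act x g))"
        unfolding smult(3) using smult(1,2) b
        by (simp only: FL.M.minus_eq a.hom_add a.hom_a_inv eL_closed FL.smult_closed FL.M.a_inv_closed e
            smult_closed linear_map_smult[OF lin])
      then show ?thesis using smult_relation[of b "act x g"] smult(1,2) act_closed g
        by (simp only: act_smult)
    qed
    then show "s \<in> {x \<in> carrier FL. ?a x \<in> RL}"
      using s relations_closed relations_in_RL by blast
  qed
  then have "RL \<subseteq> {x \<in> carrier FL. ?a x \<in> RL}"
    by (rule submodule_span_least[OF FL.preimage_submodule[OF FL.module_axioms subset_refl lin RL_submodule]])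
  then show "?a r \<in> RL" using r by blast
qed

lemma WL_eq: "WL = quot_module FL RL" by (simp add: scalar_ext_def Let_def)

lemma WL_act_eq: "scalar_ext_act L K G M act = quot_act FL RL (free_act G (carrier M) act)"
  by (simp add: scalar_ext_act_def Let_def)

lemma scalar_ext_kg_module: "kg_module L G WL (scalar_ext_act L K G M act)"
  unfolding WL_eq WL_act_eq by (rule FL.quot_kg_module[OF RL_kg_submodule])

lemma pure_tensor_closed: "pure_tensor L K M x \<in> carrier WL"
  unfolding WL_eq pure_tensor_def by (rule FL.quot_closed[OF RL_submodule eL_closed])

lemma pure_tensor_linear: "linear_map K M WL (pure_tensor L K M)"
  unfolding linear_map_def
proof (intro conjI ballI funcsetI pure_tensor_closed)
  fix x y assume xy: "x \<in> carrier M" "y \<in> carrier M"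
  have "eL (x \<oplus>\<^bsub>M\<^esub> y) \<ominus>\<^bsub>FL\<^esub> (eL x \<oplus>\<^bsub>FL\<^esub> eL y) \<in> RL"
    using add_relation[OF xy] relations_in_RL by blast
  then show "pure_tensor L K M (x \<oplus>\<^bsub>M\<^esub> y) = pure_tensor L K M x \<oplus>\<^bsub>WL\<^esub> pure_tensor L K M y"
    unfolding WL_eq pure_tensor_def FL.quot_add[OF RL_submodule eL_closed eL_closed]
    by (intro FL.quot_eq[OF RL_submodule] FL.M.a_closed eL_closed)
next
  fix a x assume ax: "a \<in> carrier K" "x \<in> carrier M"
  then have a: "a \<in> carrier L" using KL by blast
  have "eL (a \<odot>\<^bsub>M\<^esub> x) \<ominus>\<^bsub>FL\<^esub> (a \<odot>\<^bsub>FL\<^esub> eL x) \<in> RL"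
    using smult_relation[OF ax] relations_in_RL by blast
  then show "pure_tensor L K M (a \<odot>\<^bsub>M\<^esub> x) = a \<odot>\<^bsub>WL\<^esub> pure_tensor L K M x"
    unfolding WL_eq pure_tensor_def FL.quot_smult[OF RL_submodule a eL_closed]
    by (intro FL.quot_eq[OF RL_submodule] FL.smult_closed a eL_closed)
qed

lemma pure_tensor_act:
  assumes "x \<in> carrier M" "g \<in> carrier G"
  shows "pure_tensor L K M (act x g) = scalar_ext_act L K G M act (pure_tensor L K M x) g"
  unfolding WL_act_eq pure_tensor_def
  by (simp add: FL.quot_act_coset[OF RL_kg_submodule] eL_closed assms
       free_act_basis_vec[OF G.group_axioms act_closed act_one act_mult])

text \<open>Identities between linear maps on the extension need to be checked on pure tensors only.\<close>

lemma scalar_ext_generated: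
  assumes "submodule H L WL" "\<And>x. x \<in> carrier M \<Longrightarrow> pure_tensor L K M x \<in> H"
  shows "H = carrier WL"
proof -
  interpret W: kg_module L G WL "scalar_ext_act L K G M act" by (rule scalar_ext_kg_module)
  have lin: "linear_map L FL WL (\<lambda>y. RL +>\<^bsub>FL\<^esub> y)"
    unfolding WL_eq by (rule FL.quot_linear[OF RL_submodule])
  have "{y \<in> carrier FL. RL +>\<^bsub>FL\<^esub> y \<in> H} = carrier FL"
    by (rule free_module_generated[OF L FL.preimage_submodule[OF W.module_axioms subset_refl lin assms(1)]])
       (use assms(2) eL_closed in \<open>auto simp: pure_tensor_def\<close>)
  then have "A \<in> H" if "A \<in> carrier WL" for A
    using that unfolding WL_eq by (auto elim!: FL.quot_carrierE[OF RL_submodule])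
  then show ?thesis using W.submoduleE(1)[OF assms(1)] by blast
qed

text \<open>By the universal property, \<open>\<phi>\<close> extends to the free module on the elements of \<open>M\<close>, and the
  extension kills the defining relations of the tensor product.\<close>

lemma pure_tensor_nonzero:
  assumes M': "module L M'" and lin: "linear_map K M M' \<phi>"
    and x: "x \<in> carrier M" "\<phi> x \<noteq> \<zero>\<^bsub>M'\<^esub>"
  shows "pure_tensor L K M x \<noteq> \<zero>\<^bsub>WL\<^esub>"
proof
  interpret M': module L M' by fact
  assume "pure_tensor L K M x = \<zero>\<^bsub>WL\<^esub>"
  then have "RL +>\<^bsub>FL\<^esub> eL x = RL"
    by (simp add: WL_eq FL.quot_zero pure_tensor_def)
  then have ex: "eL x \<in> RL"
    using FL.M.a_coset_join1 eL_closed submodule.axioms(1)[OF RL_submodule] by blast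
  obtain \<Phi> where \<Phi>: "linear_map L FL M' \<Phi>" "\<And>y. y \<in> carrier M \<Longrightarrow> \<Phi> (eL y) = \<phi> y"
    using free_module_extend[OF M', of \<phi> "carrier M"] linear_map_closed[OF lin] by blast
  interpret \<Phi>: abelian_group_hom FL M' \<Phi>
    using linear_map_group_hom[OF \<Phi>(1)] FL.M.abelian_group_axioms M'.M.abelian_group_axioms by blast
  have zero: "submodule {\<zero>\<^bsub>M'\<^esub>} L M'" by (rule M'.submoduleI) auto
  have "scalar_ext_relations L K M \<subseteq> {y \<in> carrier FL. \<Phi> y \<in> {\<zero>\<^bsub>M'\<^esub>}}"
  proof
    fix s assume s: "s \<in> scalar_ext_relations L K M"
    then have "\<Phi> s = \<zero>\<^bsub>M'\<^esub>"
      by (cases rule: relations_cases)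
        (use KL in \<open>auto simp: FL.M.minus_eq eL_closed \<Phi>(2) linear_map_add[OF lin] linear_map_smult[OF lin]
         linear_map_smult[OF \<Phi>(1)] linear_map_closed[OF lin] M'.M.r_neg subset_iff\<close>)
    then show "s \<in> {y \<in> carrier FL. \<Phi> y \<in> {\<zero>\<^bsub>M'\<^esub>}}" using s relations_closed by auto
  qed
  then have "RL \<subseteq> {y \<in> carrier FL. \<Phi> y \<in> {\<zero>\<^bsub>M'\<^esub>}}"
    by (rule submodule_span_least[OF FL.preimage_submodule[OF M' subset_refl \<Phi>(1) zero]])
  then show False using ex \<Phi>(2)[OF x(1)] x(2) by auto
qed

end

text \<open>The hypotheses of the irreducibility criterion carry over from \<open>M\<close> to its extension of scalars,
  by naturality of the twisted sum and the conjugation trace. Only the non-vanishing of the generator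
  is not formal; the map \<open>\<phi>\<close> is there to detect it.\<close>

theorem scalar_ext_irreducible:
  fixes L :: "('k, 'u) ring_scheme"
  assumes L: "field L" and KL: "carrier K \<subseteq> carrier L" "\<zero>\<^bsub>K\<^esub> = \<zero>\<^bsub>L\<^esub>"
    and G: "finite (carrier G)" "V \<subseteq> carrier G" and f: "f \<in> V \<rightarrow> carrier K"
    and w: "w \<in> carrier M" and gen: "kg_span K G M act {w} = carrier M"
    and line: "\<And>x. x \<in> carrier M \<Longrightarrow> \<exists>c\<in>carrier K. twisted_sum M act V f x = c \<odot>\<^bsub>M\<^esub> w"
    and nu: "\<nu> \<in> carrier K" "\<nu> \<noteq> \<zero>\<^bsub>K\<^esub>"
    and scal: "\<And>x. x \<in> carrier M \<Longrightarrow> conj_trace G M act (twisted_sum M act V f) x = \<nu> \<odot>\<^bsub>M\<^esub> x"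
    and M': "module L M'" "linear_map K M M' \<phi>" "\<phi> w \<noteq> \<zero>\<^bsub>M'\<^esub>"
  shows "irreducible_kg_module L G (scalar_ext L K M) (scalar_ext_act L K G M act)"
proof -
  interpret L: field L by fact
  let ?W = "scalar_ext L K M" and ?a = "scalar_ext_act L K G M act" and ?t = "pure_tensor L K M"
  have L': "cring L" by (rule L.is_cring)
  interpret W: kg_module L G ?W ?a by (rule scalar_ext_kg_module[OF L' KL(1)])
  have t: "linear_map K M ?W ?t" by (rule pure_tensor_linear[OF L' KL(1)])
  have fin: "finite V" by (rule finite_subset[OF G(2,1)])
  have f': "f \<in> V \<rightarrow> carrier L" using f KL(1) by blast
  note cl = pure_tensor_closed[OF L' KL(1)]
  let ?T = "twisted_sum M act V f" and ?T' = "twisted_sum ?W ?a V f"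
  have T: "linear_map K M M ?T" by (rule twisted_sum_linear[OF fin G(2) f])
  have T': "linear_map L ?W ?W ?T'" by (rule W.twisted_sum_linear[OF fin G(2) f'])
  have Tt: "?t (?T x) = ?T' (?t x)" if "x \<in> carrier M" for x
    by (rule twisted_sum_natural[where act = act and act' = ?a, OF M.abelian_group_axioms W.M.abelian_group_axioms t
          act_closed pure_tensor_act[OF L' KL(1)] smult_closed fin G(2) f that])
  have Zt: "?t (conj_trace G M act ?T x) = conj_trace G ?W ?a ?T' (?t x)" if "x \<in> carrier M" for x
    by (rule conj_trace_natural[where act = act and act' = ?a and T = ?T and T' = ?T', OF G.group_axioms M.abelian_group_axioms W.M.abelian_group_axioms t
          act_closed pure_tensor_act[OF L' KL(1)] linear_map_closed[OF T] Tt G(1) that])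
  show ?thesis
  proof (rule W.irreducible_criterion[OF L G f' cl])
    show "?t w \<noteq> \<zero>\<^bsub>?W\<^esub>" by (rule pure_tensor_nonzero[OF L' KL(1) M'(1,2) w M'(3)])
    show "\<nu> \<in> carrier L" "\<nu> \<noteq> \<zero>\<^bsub>L\<^esub>" using nu KL by auto
    show "kg_span L G ?W ?a {?t w} = carrier ?W"
    proof (rule scalar_ext_generated[OF L' KL(1)])
      let ?H = "kg_span L G ?W ?a {?t w}"
      have H: "kg_submodule L G ?W ?a ?H" using W.kg_span_submodule cl by simp
      then show H': "submodule ?H L ?W" by (simp add: kg_submodule_def)
      have "kg_submodule K G M act {x \<in> carrier M. ?t x \<in> ?H}"
        unfolding kg_submodule_def
      proof (intro conjI ballI preimage_submodule[OF W.module_axioms KL(1) t H'])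
        fix x g assume "x \<in> {x \<in> carrier M. ?t x \<in> ?H}" "g \<in> carrier G"
        then show "act x g \<in> {x \<in> carrier M. ?t x \<in> ?H}"
          using H by (simp add: kg_submodule_def pure_tensor_act[OF L' KL(1)] act_closed)
      qed
      moreover have "{w} \<subseteq> {x \<in> carrier M. ?t x \<in> ?H}"
        using w kg_span_incl[of "{?t w}" L G ?W ?a] by simp
      ultimately have "kg_span K G M act {w} \<subseteq> {x \<in> carrier M. ?t x \<in> ?H}"
        by (rule kg_span_least)
      then show "?t x \<in> ?H" if "x \<in> carrier M" for x using that gen by auto
    qed
    have line_sub: "submodule {c \<odot>\<^bsub>?W\<^esub> ?t w | c. c \<in> carrier L} L ?W"
      by (rule W.line_submodule[OF cl])
    have eq: "{x \<in> carrier ?W. ?T' x \<in> {c \<odot>\<^bsub>?W\<^esub> ?t w | c. c \<in> carrier L}} = carrier ?W"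
    proof (rule scalar_ext_generated[OF L' KL(1)
          W.preimage_submodule[OF W.module_axioms subset_refl T' line_sub]])
      fix x assume x: "x \<in> carrier M"
      then obtain c where c: "c \<in> carrier K" "?T x = c \<odot>\<^bsub>M\<^esub> w" using line by blast
      then have "?T' (?t x) = c \<odot>\<^bsub>?W\<^esub> ?t w"
        using Tt[OF x] linear_map_smult[OF t _ w] by simp
      then show "?t x \<in> {x \<in> carrier ?W. ?T' x \<in> {c \<odot>\<^bsub>?W\<^esub> ?t w | c. c \<in> carrier L}}"
        using c(1) KL(1) cl by blast
    qed
    show "\<exists>c\<in>carrier L. ?T' x = c \<odot>\<^bsub>?W\<^esub> ?t w" if "x \<in> carrier ?W" for x
      using subsetD[OF equalityD2[OF eq] that] by simp blast
    have eq: "{x \<in> carrier ?W. conj_trace G ?W ?a ?T' x = \<nu> \<odot>\<^bsub>?W\<^esub> x} = carrier ?W"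
    proof (rule scalar_ext_generated[OF L' KL(1) W.equalizer_submodule[OF W.module_axioms
            W.conj_trace_linear[OF G(1) T'] W.linear_map_scale]])
      fix x assume x: "x \<in> carrier M"
      then show "?t x \<in> {x \<in> carrier ?W. conj_trace G ?W ?a ?T' x = \<nu> \<odot>\<^bsub>?W\<^esub> x}"
        using Zt[OF x, symmetric] scal nu linear_map_smult[OF t] cl by simp
    qed (use nu KL in auto)
    show "conj_trace G ?W ?a ?T' x = \<nu> \<odot>\<^bsub>?W\<^esub> x" if "x \<in> carrier ?W" for x
      using subsetD[OF equalityD2[OF eq] that] by simp
  qed
qed

end

section \<open>Algebraic closures inside the complex numbers\<close>

lemma complex_ring_sel:
  shows "carrier (ring_of_type_algebra :: complex ring) = UNIV"
    and "x \<otimes>\<^bsub>ring_of_type_algebra\<^esub> y = x * y"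
    and "x \<oplus>\<^bsub>ring_of_type_algebra\<^esub> y = x + y"
    and "\<one>\<^bsub>ring_of_type_algebra :: complex ring\<^esub> = 1"
    and "\<zero>\<^bsub>ring_of_type_algebra :: complex ring\<^esub> = 0"
  by (simp_all add: ring_of_type_algebra_def)

lemma complex_ring_pow: "x [^]\<^bsub>ring_of_type_algebra :: complex ring\<^esub> (n::nat) = x ^ n"
proof -
  interpret C: field "ring_of_type_algebra :: complex ring" by (rule field_from_type_algebra)
  show ?thesis by (induction n) (simp_all add: complex_ring_sel)
qed

lemma complex_ring_eval:
  "ring.eval (ring_of_type_algebra :: complex ring) p x = poly (Poly (rev p)) x"
proof -
  interpret C: field "ring_of_type_algebra :: complex ring" by (rule field_from_type_algebra)
  show ?thesis
    by (induction p) (simp_all add: complex_ring_sel complex_ring_pow Poly_append poly_monom add.commute mult.commute)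
qed

text \<open>Let \<open>Q\<close> be an irreducible factor, over the algebraic numbers, of a polynomial \<open>P\<close> over \<open>F\<close>. By
  the fundamental theorem of algebra \<open>Q\<close> has a complex root if its degree is positive; the root is
  also one of \<open>P\<close>, hence algebraic over \<open>F\<close>, and so \<open>Q\<close> has degree one.\<close>

theorem algebraic_numbers_closure:
  fixes F :: "complex set"
  assumes F: "subfield F (ring_of_type_algebra :: complex ring)"
  defines "A \<equiv> {x. (ring.algebraic (ring_of_type_algebra :: complex ring) over F) x}"
  shows "algebraic_closure ((ring_of_type_algebra :: complex ring)\<lparr>carrier := A\<rparr>) F"
    and "F \<subseteq> A"
proof -
  define C where "C = (ring_of_type_algebra :: complex ring)"
  interpret C: field C unfolding C_def by (rule field_from_type_algebra)
  note sel = complex_ring_sel[folded C_def]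
  have F': "subfield F C" using F unfolding C_def .
  have A_eq: "A = {x \<in> carrier C. (C.algebraic over F) x}"
    unfolding A_def by (simp add: complex_ring_sel C_def)
  have A: "subfield A C" unfolding A_eq by (rule C.subfield_of_algebraics[OF F'])
  let ?L = "C\<lparr>carrier := A\<rparr>"
  interpret L: field ?L using C.subfield_iff(2)[OF A] .
  show FA: "F \<subseteq> A"
    using C.algebraic_self[OF subfieldE(1)[OF F']] by (auto simp: A_eq sel)
  have FL: "subfield F ?L"
  proof (rule L.subfield_iff(1))
    show "field (?L\<lparr>carrier := F\<rparr>)" using C.subfield_iff(2)[OF F'] by simp
  qed (use FA in simp)
  have poly_A: "carrier (poly_ring ?L) = carrier (A[X]\<^bsub>C\<^esub>)"
    using C.univ_poly_consistent[OF subfieldE(1)[OF A]] by simp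
  have eval: "L.eval p x = poly (Poly (rev p)) x" for p x
    using C.eval_consistent[OF subfieldE(1)[OF A]] complex_ring_eval by (simp add: C_def)
  have split: "L.splitted P" if P: "P \<in> carrier (F[X]\<^bsub>?L\<^esub>)" for P
  proof (cases "P = []")
    case True
    then show ?thesis using L.degree_zero_imp_splitted P L.carrier_polynomial_shell[OF subfieldE(1)[OF FL]] by simp
  next
    case nz: False
    have PL: "P \<in> carrier (poly_ring ?L)"
      using P L.carrier_polynomial_shell[OF subfieldE(1)[OF FL]] by simp
    have PF: "P \<in> carrier (F[X]\<^bsub>C\<^esub>)"
      using P C.univ_poly_consistent[OF subfieldE(1)[OF A]] 
        C.univ_poly_consistent[OF subfieldE(1)[OF F']] L.univ_poly_consistent[OF subfieldE(1)[OF FL]] by simp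
    show ?thesis
    proof (rule L.trivial_factors_imp_splitted[OF PL], rule ccontr)
      fix Q assume Q: "Q \<in> carrier (poly_ring ?L)" "pirreducible\<^bsub>?L\<^esub> (carrier ?L) Q"
        and QP: "Q pdivides\<^bsub>?L\<^esub> P" and deg: "\<not> length Q - 1 \<le> 1"
      then have Q0: "Q \<noteq> []" and lead: "hd Q \<noteq> 0"
        using Q(1) unfolding univ_poly_carrier[symmetric] polynomial_def by (auto simp: sel)
      have "\<not> constant (poly (Poly (rev Q)))"
      proof -
        have "Polynomial.coeff (Poly (rev Q)) (length Q - 1) = hd Q"
          using Q0 by (simp add: coeff_Poly_eq nth_default_def rev_nth hd_conv_nth)
        with lead have "length Q - 1 \<le> Polynomial.degree (Poly (rev Q))"
          by (intro le_degree) simp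
        then show ?thesis using deg by (simp add: constant_degree)
      qed
      then obtain a where a: "poly (Poly (rev Q)) a = 0"
        using fundamental_theorem_of_algebra by blast
      have QC: "Q \<in> carrier (A[X]\<^bsub>C\<^esub>)" "P \<in> carrier (A[X]\<^bsub>C\<^esub>)" using Q PL poly_A by auto
      then have Q': "Q \<in> carrier (poly_ring C)" 
        using C.carrier_polynomial_shell[OF subfieldE(1)[OF A]] by auto
      have "Q divides\<^bsub>A[X]\<^bsub>C\<^esub>\<^esub> P"
        using QP C.univ_poly_consistent[OF subfieldE(1)[OF A]] by (simp add: pdivides_def)
      then have "Q pdivides\<^bsub>C\<^esub> P"
        using C.pdivides_iff_shell[OF A QC] by simp
      then have "C.eval P a = \<zero>\<^bsub>C\<^esub>"
        using C.pdivides_imp_root_sharing[OF Q', of P a] a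
        by (simp add: sel complex_ring_eval[folded C_def])
      then have "(C.algebraic over F) a" by (rule C.algebraicI[OF PF nz])
      then have aA: "a \<in> A" by (simp add: A_eq sel)
      have "L.is_root Q a" unfolding L.is_root_def eval using a aA Q0 by (simp add: sel)
      then have "L.roots Q \<noteq> {#}" using L.roots_mem_iff_is_root[OF Q(1)] by auto
      moreover have "length Q - 1 \<noteq> 1" using deg by simp
      ultimately show False using L.pirreducible_roots[OF Q] by blast
    qed
  qed
  have "algebraic_closure ?L F"
  proof (intro algebraic_closure.intro algebraic_closure_axioms.intro L.field_axioms FL split)
    fix x assume "x \<in> carrier ?L"
    then have "\<not> C.transcendental F x" by (simp add: A_eq over_def)
    then show "(L.algebraic over F) x"
      unfolding over_def C.transcendental_consistent[OF subfieldE(1)[OF A], symmetric] .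
  qed
  then show "algebraic_closure ((ring_of_type_algebra :: complex ring)\<lparr>carrier := A\<rparr>) F"
    unfolding C_def .
qed

section \<open>A James triple with a fitting character\<close>

locale james_character = james_triple G U V N k
  for G :: "('g, 's) monoid_scheme" (structure) and U V N :: "'g set" and k :: nat +
  fixes F :: "complex set" and f :: "'g \<Rightarrow> complex"
  assumes fin: "finite (carrier G)"
    and F: "subfield F (ring_of_type_algebra :: complex ring)"
    and cnj_F: "z \<in> F \<Longrightarrow> cnj z \<in> F"
    and fits: "fits ((ring_of_type_algebra :: complex ring)\<lparr>carrier := F\<rparr>) (restrict cnj F) G V N f"
begin

abbreviation "K \<equiv> (ring_of_type_algebra :: complex ring)\<lparr>carrier := F\<rparr>"
abbreviation "B \<equiv> rcosets U"
abbreviation "M \<equiv> perm_module K G U"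
abbreviation "act \<equiv> perm_act G U"

lemma K_sel: "carrier K = F" "x \<otimes>\<^bsub>K\<^esub> y = x * y" "x \<oplus>\<^bsub>K\<^esub> y = x + y" "\<one>\<^bsub>K\<^esub> = 1" "\<zero>\<^bsub>K\<^esub> = 0"
  by (simp_all add: complex_ring_sel)

lemma field_K: "field K"
proof -
  interpret C: field "ring_of_type_algebra :: complex ring" by (rule field_from_type_algebra)
  show ?thesis by (rule C.subfield_iff(2)[OF F])
qed

sublocale K: field K by (rule field_K)

lemma F_closed:
  shows F_add: "x \<in> F \<Longrightarrow> y \<in> F \<Longrightarrow> x + y \<in> F" and F_mult: "x \<in> F \<Longrightarrow> y \<in> F \<Longrightarrow> x * y \<in> F"
    and F_0: "0 \<in> F" and F_1: "1 \<in> F"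
  using K.a_closed[of x y] K.m_closed[of x y] K.zero_closed K.one_closed by (simp_all add: complex_ring_sel)

lemma F_sum: "(\<And>i. i \<in> I \<Longrightarrow> h i \<in> F) \<Longrightarrow> sum h I \<in> F"
  by (induction I rule: infinite_finite_induct) (auto simp: F_closed)

lemma F_of_nat: "of_nat n \<in> F"
  by (induction n) (auto simp: F_closed)

lemma F_divide: "x \<in> F \<Longrightarrow> y \<in> F \<Longrightarrow> x / y \<in> F"
proof (cases "y = 0")
  case False
  assume x: "x \<in> F" and y: "y \<in> F"
  then have "y \<in> Units K" using False by (simp add: K.field_Units complex_ring_sel)
  then have "inv\<^bsub>K\<^esub> y \<in> F" "inv\<^bsub>K\<^esub> y * y = 1"
    using K.Units_inv_closed[of y] K.Units_l_inv[of y] by (simp_all add: complex_ring_sel)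
  then have "x / y = x * inv\<^bsub>K\<^esub> y" using False by (simp add: field_simps)
  then show ?thesis using F_mult x \<open>inv\<^bsub>K\<^esub> y \<in> F\<close> by simp
qed (simp add: F_0)

lemma finsum_K:
  assumes "finite I" "\<And>i. i \<in> I \<Longrightarrow> h i \<in> F"
  shows "(\<Oplus>\<^bsub>K\<^esub>i\<in>I. h i) = sum h I"
  using assms
proof (induction I)
  case (insert i I)
  then have "h \<in> I \<rightarrow> carrier K" "h i \<in> carrier K" by (auto simp: complex_ring_sel)
  with insert show ?case by (simp add: K.finsum_insert complex_ring_sel)
qed (simp add: complex_ring_sel)

lemma V_sub: "v \<in> V \<Longrightarrow> v \<in> carrier G" and N_sub: "n \<in> N \<Longrightarrow> n \<in> V"
  and U_sub: "u \<in> U \<Longrightarrow> u \<in> carrier G"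
  using subgroup.subset[OF subgroup_V] normal_imp_subgroup[OF J2_normal] subgroup.subset subgroup.subset[OF subgroup_U]
  by fastforce+

lemma fin_V: "finite V" and fin_U: "finite U"
  using fin subgroup.subset[OF subgroup_V] subgroup.subset[OF subgroup_U] finite_subset by blast+

lemma f_F: "v \<in> V \<Longrightarrow> f v \<in> F"
  and f_mult: "v \<in> V \<Longrightarrow> w \<in> V \<Longrightarrow> f (v \<otimes> w) = f v * f w"
  using fits by (auto simp: fits_def hom_def roots_of_unity_def complex_ring_sel Pi_iff)

text \<open>Roots of unity in the complex numbers have absolute value \<open>1\<close>.\<close>

lemma f_norm:
  assumes "v \<in> V"
  shows "cnj (f v) * f v = 1"
proof -
  have "f v \<in> carrier (roots_of_unity K)"
    using fits assms by (auto simp: fits_def hom_def)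
  then obtain n :: nat where n: "n > 0" "f v [^]\<^bsub>K\<^esub> n = 1"
    by (auto simp: roots_of_unity_def complex_ring_sel)
  have "x [^]\<^bsub>K\<^esub> m = x ^ m" for x and m :: nat
    by (induction m) (simp_all add: complex_ring_sel)
  then have "cmod (f v) ^ n = 1 ^ n" using n(2) by (simp flip: norm_power)
  then have "cmod (f v) = 1" using n(1) power_eq_imp_eq_base[of "cmod (f v)" n 1] by simp
  then show ?thesis by (metis complex_norm_square mult.commute of_real_1 one_power2)
qed

lemma f_one: "f \<one> = 1"
  using f_mult[of \<one> \<one>] f_norm[of \<one>] subgroup.one_closed[OF subgroup_V] by auto

lemma V_closed: "v \<in> V \<Longrightarrow> w \<in> V \<Longrightarrow> v \<otimes> w \<in> V" "v \<in> V \<Longrightarrow> inv v \<in> V"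
  using subgroup.m_closed[OF subgroup_V] subgroup.m_inv_closed[OF subgroup_V] by auto

lemma f_inv: "v \<in> V \<Longrightarrow> f (inv v) = cnj (f v)"
proof -
  assume v: "v \<in> V"
  then have "f (inv v) * f v = 1" using f_mult[of "inv v" v] f_one V_closed V_sub by simp
  then show ?thesis using f_norm[OF v] by (metis mult_cancel_right mult_zero_right zero_neq_one)
qed

lemma f_N: "n \<in> N \<Longrightarrow> f n = 1"
  using fits by (auto simp: fits_def Let_def kernel_def roots_of_unity_def complex_ring_sel split: if_splits)

text \<open>The characteristic is \<open>0\<close>, which does not divide the index \<open>k \<ge> 2\<close>; so the fitting condition
  makes the kernel a proper subgroup.\<close>

lemma f_nontrivial: "\<exists>w\<in>V. f w \<noteq> 1"
proof -
  have "\<not> ring_char K dvd Coset.order (G\<lparr>carrier := V\<rparr> Mod N)"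
  proof
    assume "ring_char K dvd Coset.order (G\<lparr>carrier := V\<rparr> Mod N)"
    then have "ring_char K dvd k" using J2_index by simp
    then have "[k] \<cdot>\<^bsub>K\<^esub> \<one>\<^bsub>K\<^esub> = \<zero>\<^bsub>K\<^esub>"
      using K.add.pow_eq_id[of "\<one>\<^bsub>K\<^esub>" k] K.one_closed by (simp add: ring_char_def complex_ring_sel)
    moreover have "[m] \<cdot>\<^bsub>K\<^esub> \<one>\<^bsub>K\<^esub> = of_nat m" for m
      by (induction m) (simp_all add: complex_ring_sel)
    ultimately show False using index_ge_2 by (simp add: complex_ring_sel)
  qed
  then show ?thesis using fits
    by (auto simp: fits_def Let_def kernel_def roots_of_unity_def complex_ring_sel)
qed

section \<open>The permutation module and its form\<close>

lemma fin_B: "finite B"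
  using fin by (simp add: RCOSETS_def)

lemma U_subset: "U \<subseteq> carrier G" by (rule subgroup.subset[OF subgroup_U])

lemma B_E:
  assumes "C \<in> B" obtains g where "g \<in> carrier G" "C = U #> g"
  using assms by (auto simp: RCOSETS_def)

lemma B_I: "g \<in> carrier G \<Longrightarrow> U #> g \<in> B"
  by (auto simp: RCOSETS_def)

lemma B_act: "C \<in> B \<Longrightarrow> g \<in> carrier G \<Longrightarrow> C #> g \<in> B"
  by (auto elim!: B_E simp: coset_mult_assoc U_subset B_I)

lemma B_one: "C \<in> B \<Longrightarrow> C #> \<one> = C"
  by (auto elim!: B_E simp: coset_mult_assoc U_subset)

lemma B_mult: "C \<in> B \<Longrightarrow> g \<in> carrier G \<Longrightarrow> h \<in> carrier G \<Longrightarrow> C #> (g \<otimes> h) = C #> g #> h"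
  by (auto elim!: B_E simp: coset_mult_assoc U_subset m_assoc)

sublocale M: kg_module K G M act
  unfolding perm_module_def perm_act_def
  by (rule free_module_kg_module[OF K.is_cring group_axioms B_act B_one B_mult])

lemma M_carrier: "x \<in> carrier M \<longleftrightarrow> x \<in> B \<rightarrow>\<^sub>E F"
  using fin_B by (simp add: perm_module_def free_carrier complex_ring_sel)

lemma M_F: "x \<in> carrier M \<Longrightarrow> C \<in> B \<Longrightarrow> x C \<in> F"
  by (auto simp: M_carrier)

lemma M_eqI:
  "x \<in> carrier M \<Longrightarrow> y \<in> carrier M \<Longrightarrow> (\<And>g. g \<in> carrier G \<Longrightarrow> x (U #> g) = y (U #> g)) \<Longrightarrow> x = y"
  unfolding perm_module_def by (rule free_module_eqI) (auto elim: B_E)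

lemma smult_apply: "C \<in> B \<Longrightarrow> (a \<odot>\<^bsub>M\<^esub> x) C = a * x C"
  by (simp add: perm_module_def free_smult complex_ring_sel)

lemma act_apply: "C \<in> B \<Longrightarrow> act x g C = x (C #> inv g)"
  by (simp add: perm_act_def free_act_def)

lemma finsum_apply:
  assumes "finite I" "\<And>i. i \<in> I \<Longrightarrow> h i \<in> carrier M" "C \<in> B"
  shows "(\<Oplus>\<^bsub>M\<^esub>i\<in>I. h i) C = (\<Sum>i\<in>I. h i C)"
proof -
  have "(\<Oplus>\<^bsub>M\<^esub>i\<in>I. h i) C = (\<Oplus>\<^bsub>K\<^esub>i\<in>I. h i C)"
    unfolding perm_module_def
    by (rule free_finsum_apply[OF K.is_cring assms(1) _ assms(3)])
      (use assms(2) in \<open>auto simp: perm_module_def\<close>)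
  also have "\<dots> = (\<Sum>i\<in>I. h i C)"
    by (rule finsum_K[OF assms(1)]) (use assms M_F in blast)
  finally show ?thesis .
qed

text \<open>The invariant form as a sum of complex numbers, defined for all functions on the cosets.\<close>

definition ip :: "('g set \<Rightarrow> complex) \<Rightarrow> ('g set \<Rightarrow> complex) \<Rightarrow> complex" where
  "ip x y = (\<Sum>C\<in>B. x C * cnj (y C))"

lemma perm_form_eq:
  assumes "x \<in> carrier M" "y \<in> carrier M"
  shows "perm_form K G U (restrict cnj F) x y = ip x y"
proof -
  have "perm_form K G U (restrict cnj F) x y = (\<Sum>C\<in>B. x C * restrict cnj F (y C))"
    unfolding perm_form_def K_sel
    by (rule finsum_K[OF fin_B]) (use assms M_F cnj_F F_mult in auto)
  also have "\<dots> = ip x y"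
    unfolding ip_def by (rule sum.cong) (use assms M_F in auto)
  finally show ?thesis .
qed

lemma ip_F: "x \<in> carrier M \<Longrightarrow> y \<in> carrier M \<Longrightarrow> ip x y \<in> F"
  unfolding ip_def by (intro F_sum F_mult cnj_F M_F)

lemma ip_sym: "cnj (ip x y) = ip y x"
  by (simp add: ip_def mult.commute)

lemma ip_self: "ip x x = of_real (\<Sum>C\<in>B. (cmod (x C))\<^sup>2)"
  by (simp add: ip_def complex_norm_square del: of_real_power)

lemma ip_definite:
  assumes "ip x x = 0" "C \<in> B"
  shows "x C = 0"
proof -
  have "(\<Sum>C\<in>B. (cmod (x C))\<^sup>2) = 0" using assms(1) by (simp only: ip_self of_real_eq_0_iff)
  then show ?thesis using assms(2) fin_B by (simp add: sum_nonneg_eq_0_iff)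
qed

lemma ip_act:
  assumes "g \<in> carrier G"
  shows "ip (act x g) (act y g) = ip x y"
proof -
  have "bij_betw (\<lambda>C. C #> inv g) B B"
    by (rule bij_betw_byWitness[where f' = "\<lambda>C. C #> g"])
       (use assms in \<open>auto simp: B_act B_mult[symmetric] B_one\<close>)
  from sum.reindex_bij_betw[OF this, of "\<lambda>C. x C * cnj (y C)"] show ?thesis
    by (simp add: ip_def act_apply)
qed

lemma act_inv: "x \<in> carrier M \<Longrightarrow> g \<in> carrier G \<Longrightarrow> act (act x (inv g)) g = x"
  by (simp add: M.act_mult[symmetric] M.act_one)

lemma ip_act_left:
  assumes "g \<in> carrier G" "y \<in> carrier M"
  shows "ip (act x g) y = ip x (act y (inv g))"
  using ip_act[OF assms(1), of x "act y (inv g)"] act_inv[OF assms(2,1)] by simp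

lemma ip_finsum:
  assumes "finite I" "\<And>i. i \<in> I \<Longrightarrow> h i \<in> carrier M"
  shows "ip (\<Oplus>\<^bsub>M\<^esub>i\<in>I. h i) y = (\<Sum>i\<in>I. ip (h i) y)"
  unfolding ip_def
  by (subst sum.swap) (simp add: finsum_apply assms sum_distrib_right)

lemma ip_smult: "ip (a \<odot>\<^bsub>M\<^esub> x) y = a * ip x y"
  by (simp add: ip_def smult_apply sum_distrib_left mult.assoc)

section \<open>Twisting by the character projects onto a line\<close>

definition x0 :: "'g set \<Rightarrow> complex" where
  "x0 = (\<Oplus>\<^bsub>M\<^esub>v\<in>V. f v \<odot>\<^bsub>M\<^esub> basis_vec K B (U #> v))"

lemma basis_closed: "basis_vec K B C \<in> carrier M"
  unfolding perm_module_def by (rule basis_vec_closed[OF K.is_cring])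

lemma x0_terms: "v \<in> V \<Longrightarrow> f v \<odot>\<^bsub>M\<^esub> basis_vec K B (U #> v) \<in> carrier M"
  by (rule M.smult_closed) (simp_all add: f_F basis_closed complex_ring_sel)

lemma x0_closed: "x0 \<in> carrier M"
  unfolding x0_def using x0_terms by (intro M.M.finsum_closed) blast

lemma x0_apply:
  assumes "C \<in> B"
  shows "x0 C = (\<Sum>v\<in>V. f v * (if C = U #> v then 1 else 0))"
  unfolding x0_def
  by (subst finsum_apply[OF fin_V x0_terms assms])
    (simp_all add: smult_apply assms basis_vec_def complex_ring_sel cong: if_cong)

lemma ip_x0:
  assumes "x \<in> carrier M"
  shows "ip x x0 = (\<Sum>v\<in>V. cnj (f v) * x (U #> v))"
proof -
  have "ip x x0 = (\<Sum>C\<in>B. \<Sum>v\<in>V. if C = U #> v then cnj (f v) * x C else 0)"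
    unfolding ip_def
    by (intro sum.cong refl) (auto simp: x0_apply sum_distrib_left cong: if_cong intro!: sum.cong)
  also have "\<dots> = (\<Sum>v\<in>V. \<Sum>C\<in>B. if C = U #> v then cnj (f v) * x C else 0)"
    by (rule sum.swap)
  also have "\<dots> = (\<Sum>v\<in>V. cnj (f v) * x (U #> v))"
    using fin_B B_I V_sub by (intro sum.cong refl) (simp add: sum.delta)
  finally show ?thesis .
qed

abbreviation "d \<equiv> card (U \<inter> V)"

lemma d_pos: "d > 0"
  using fin_U subgroup.one_closed[OF subgroup_U] subgroup.one_closed[OF subgroup_V]
  by (auto simp: card_gt_0_iff)

lemma coset_eq: "g \<in> carrier G \<Longrightarrow> h \<in> carrier G \<Longrightarrow> U #> g = U #> h \<longleftrightarrow> (\<exists>u\<in>U. g = u \<otimes> h)"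
proof
  assume g: "g \<in> carrier G" "h \<in> carrier G" and "U #> g = U #> h"
  then have "g \<in> U #> h" using rcos_self[OF g(1) subgroup_U] by simp
  then show "\<exists>u\<in>U. g = u \<otimes> h" by (auto simp: r_coset_def)
next
  assume g: "g \<in> carrier G" "h \<in> carrier G" and "\<exists>u\<in>U. g = u \<otimes> h"
  then have "g \<in> U #> h" by (auto simp: r_coset_def)
  then show "U #> g = U #> h" using repr_independence[OF _ g(2) subgroup_U] by simp
qed

lemma x0_on:
  assumes "v \<in> V"
  shows "x0 (U #> v) = of_nat d * f v"
proof -
  have eq: "{w \<in> V. U #> v = U #> w} = (\<lambda>u. u \<otimes> v) ` (U \<inter> V)"
  proof (intro equalityI subsetI)
    fix w assume "w \<in> {w \<in> V. U #> v = U #> w}"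
    then have w: "w \<in> V" "U #> w = U #> v" by auto
    then obtain u where u: "u \<in> U" "w = u \<otimes> v" using coset_eq V_sub assms by blast
    then have "u = w \<otimes> inv v" using V_sub[OF assms] U_sub by (simp add: m_assoc)
    then have "u \<in> V" using w V_closed assms by blast
    then show "w \<in> (\<lambda>u. u \<otimes> v) ` (U \<inter> V)" using u by blast
  next
    fix w assume "w \<in> (\<lambda>u. u \<otimes> v) ` (U \<inter> V)"
    then obtain u where u: "u \<in> U" "u \<in> V" "w = u \<otimes> v" by blast
    then have "w \<in> V" using V_closed assms by blast
    moreover have "U #> w = U #> v" using coset_eq[of w v] u V_sub assms \<open>w \<in> V\<close> by blast
    ultimately show "w \<in> {w \<in> V. U #> v = U #> w}" by simp
  qed
  have inj: "inj_on (\<lambda>u. u \<otimes> v) (U \<inter> V)"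
    using V_sub assms by (auto intro!: inj_onI)
  have "x0 (U #> v) = (\<Sum>w\<in>{w \<in> V. U #> v = U #> w}. f w)"
    using fin_V V_sub assms by (simp add: x0_apply B_I sum.inter_filter if_distrib cong: if_cong)
  also have "\<dots> = (\<Sum>u\<in>U \<inter> V. f (u \<otimes> v))"
    unfolding eq by (rule sum.reindex[OF inj, unfolded o_def])
  also have "\<dots> = (\<Sum>u\<in>U \<inter> V. f v)"
    using f_mult f_N J1 assms by (intro sum.cong) auto
  finally show ?thesis by simp
qed

lemma x0_off:
  assumes "g \<in> carrier G" "g \<notin> U <#> V"
  shows "x0 (U #> g) = 0"
proof -
  have "U #> g \<noteq> U #> v" if "v \<in> V" for v
    using coset_eq[of g v] assms that V_sub by (auto simp: set_mult_def)
  then show ?thesis using assms(1) by (simp add: x0_apply B_I)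
qed

abbreviation "T \<equiv> twisted_sum M act V f"
abbreviation "Z \<equiv> conj_trace G M act T"

lemma f_K: "f \<in> V \<rightarrow> carrier K" using f_F by (auto simp: complex_ring_sel)

lemma V_G: "V \<subseteq> carrier G" using V_sub by blast

lemma T_linear: "linear_map K M M T"
  by (rule M.twisted_sum_linear[OF fin_V V_G f_K])

lemma Z_linear: "linear_map K M M Z"
  by (rule M.conj_trace_linear[OF fin T_linear])

lemma T_apply:
  assumes "x \<in> carrier M" "C \<in> B"
  shows "T x C = (\<Sum>v\<in>V. f v * x (C #> inv v))"
proof -
  have "f v \<odot>\<^bsub>M\<^esub> act x v \<in> carrier M" if "v \<in> V" for v
    using that assms(1) f_K V_sub by (intro M.smult_closed M.act_closed) auto
  then show ?thesis
    unfolding twisted_sum_def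
    by (subst finsum_apply[OF fin_V _ assms(2)]) (simp_all add: smult_apply act_apply assms(2))
qed

lemma V_translate: "w \<in> V \<Longrightarrow> bij_betw (\<lambda>v. v \<otimes> w) V V"
  by (rule bij_betw_byWitness[where f' = "\<lambda>v. v \<otimes> inv w"])
     (auto simp: V_closed V_sub m_assoc)

text \<open>Substituting \<open>w\<inverse>v\<close> for the summation variable turns the coefficient into the form with
  \<open>x0\<close>, since \<open>f (w\<inverse>) = cnj (f w)\<close>.\<close>

lemma T_on:
  assumes "x \<in> carrier M" "v \<in> V"
  shows "T x (U #> v) = f v * ip x x0"
proof -
  have cancel: "a \<otimes> (inv a \<otimes> b) = b" if "a \<in> V" "b \<in> V" for a b
    using that V_sub by (simp add: m_assoc[symmetric])
  have bij: "bij_betw (\<lambda>w. inv w \<otimes> v) V V"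
    by (rule bij_betw_byWitness[where f' = "\<lambda>w. v \<otimes> inv w"])
       (use assms(2) in \<open>auto simp: V_closed V_sub m_assoc inv_mult_group cancel\<close>)
  have "T x (U #> v) = (\<Sum>w\<in>V. f w * x (U #> v #> inv w))"
    using assms V_sub B_I by (simp add: T_apply)
  also have "\<dots> = (\<Sum>w\<in>V. f (inv w \<otimes> v) * x (U #> v #> inv (inv w \<otimes> v)))"
    by (rule sum.reindex_bij_betw[OF bij, symmetric])
  also have "\<dots> = (\<Sum>w\<in>V. f v * (cnj (f w) * x (U #> w)))"
  proof (rule sum.cong)
    fix w assume w: "w \<in> V"
    have "U #> v #> inv (inv w \<otimes> v) = U #> w"
      using w assms V_sub U_subset by (simp add: coset_mult_assoc inv_mult_group m_assoc[symmetric])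
    then show "f (inv w \<otimes> v) * x (U #> v #> inv (inv w \<otimes> v)) = f v * (cnj (f w) * x (U #> w))"
      using w assms by (simp add: f_mult f_inv V_closed)
  qed simp
  finally show ?thesis by (simp add: ip_x0[OF assms(1)] sum_distrib_left)
qed

text \<open>By (J3) with \<open>f w \<noteq> 1\<close> the set \<open>wN \<inter> U\<^sup>g\<close> is as large as \<open>N \<inter> U\<^sup>g\<close>, which contains \<open>1\<close>. So there is
  \<open>u \<in> V \<inter> U\<^sup>g\<close> with \<open>f u = f w \<noteq> 1\<close>. As \<open>Ugu = Ug\<close>, translating the summation variable by \<open>u\<close>
  multiplies the coefficient at \<open>Ug\<close> by \<open>cnj (f u)\<close>, and it must vanish.\<close>

lemma T_off:
  assumes "x \<in> carrier M" "g \<in> carrier G" "g \<notin> U <#> V"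
  shows "T x (U #> g) = 0"
proof -
  obtain w where w: "w \<in> V" "f w \<noteq> 1" using f_nontrivial by blast
  have one: "\<one> \<in> N \<inter> conj_set G U g"
    using subgroup.one_closed[OF subgroup_N] subgroup.one_closed[OF subgroup_U] assms(2)
    unfolding conj_set_def by (force simp: r_coset_def l_coset_def)
  have "finite (N \<inter> conj_set G U g)" using N_sub fin_V by (meson finite_Int finite_subset subsetI)
  then have "card (N \<inter> conj_set G U g) \<noteq> 0" using one by auto
  then have "(w <# N) \<inter> conj_set G U g \<noteq> {}"
    using J3[of g w] assms w by force
  then obtain u n where u: "n \<in> N" "u = w \<otimes> n" "u \<in> conj_set G U g"
    by (auto simp: l_coset_def)
  then have uV: "u \<in> V" and fu: "f u \<noteq> 1" using w N_sub V_closed f_mult f_N by auto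
  obtain u' where u': "u' \<in> U" "u = inv g \<otimes> u' \<otimes> g"
    using u(3) by (auto simp: conj_set_def r_coset_def l_coset_def)
  have Ugu: "U #> g #> u = U #> g"
  proof -
    have "g \<otimes> u = u' \<otimes> g" using u' U_sub assms(2) by (simp add: m_assoc[symmetric])
    then show ?thesis using coset_eq[of "g \<otimes> u" g] assms(2) uV V_sub u'(1) U_subset
      by (auto simp: coset_mult_assoc)
  qed
  have "T x (U #> g) = (\<Sum>v\<in>V. f v * x (U #> g #> inv v))"
    using assms by (simp add: T_apply B_I)
  also have "\<dots> = (\<Sum>v\<in>V. f (v \<otimes> inv u) * x (U #> g #> inv (v \<otimes> inv u)))"
    by (rule sum.reindex_bij_betw[OF V_translate, symmetric]) (rule V_closed(2)[OF uV])
  also have "\<dots> = (\<Sum>v\<in>V. cnj (f u) * (f v * x (U #> g #> inv v)))"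
  proof (rule sum.cong)
    fix v assume v: "v \<in> V"
    have "U #> g #> inv (v \<otimes> inv u) = U #> g #> u #> inv v"
      using v uV V_sub assms(2) U_subset by (simp add: coset_mult_assoc inv_mult_group m_assoc)
    then show "f (v \<otimes> inv u) * x (U #> g #> inv (v \<otimes> inv u)) = cnj (f u) * (f v * x (U #> g #> inv v))"
      using v uV by (simp add: f_mult f_inv V_closed Ugu)
  qed simp
  also have "\<dots> = cnj (f u) * T x (U #> g)"
    using assms by (simp add: T_apply B_I sum_distrib_left)
  finally have "(1 - cnj (f u)) * T x (U #> g) = 0" by (simp add: algebra_simps)
  moreover have "cnj (f u) \<noteq> 1" using fu by (metis complex_cnj_cnj complex_cnj_one)
  ultimately show ?thesis by simp
qed

text \<open>Up to a nonzero factor, \<open>T\<close> is the orthogonal projection onto the line of \<open>x0\<close>.\<close>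

lemma T_eq:
  assumes "x \<in> carrier M"
  shows "T x = (ip x x0 / of_nat d) \<odot>\<^bsub>M\<^esub> x0" and "ip x x0 / of_nat d \<in> F"
proof -
  show c: "ip x x0 / of_nat d \<in> F" by (intro F_divide ip_F assms x0_closed F_of_nat)
  show "T x = (ip x x0 / of_nat d) \<odot>\<^bsub>M\<^esub> x0"
  proof (rule M_eqI)
    show "T x \<in> carrier M" by (rule linear_map_closed[OF T_linear assms])
    show "(ip x x0 / of_nat d) \<odot>\<^bsub>M\<^esub> x0 \<in> carrier M"
      using c x0_closed by (intro M.smult_closed) (simp_all add: complex_ring_sel)
    fix g assume g: "g \<in> carrier G"
    show "T x (U #> g) = ((ip x x0 / of_nat d) \<odot>\<^bsub>M\<^esub> x0) (U #> g)"
    proof (cases "g \<in> U <#> V")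
      case True
      then obtain u v where uv: "u \<in> U" "v \<in> V" "g = u \<otimes> v" by (auto simp: set_mult_def)
      then have "U #> g = U #> v" using coset_eq[OF g, of v] V_sub by blast
      then show ?thesis using uv assms V_sub d_pos
        by (simp add: T_on x0_on smult_apply B_I)
    qed (use assms g in \<open>simp add: T_off x0_off smult_apply B_I\<close>)
  qed
qed


section \<open>The conjugation trace acts on the generated submodule as a scalar\<close>

lemma x0_U: "x0 U = of_nat d"
  using x0_on[OF subgroup.one_closed[OF subgroup_V]] by (simp add: coset_mult_one U_subset f_one)

lemma U_in_B: "U \<in> B"
  using B_I[OF one_closed] by (simp add: coset_mult_one U_subset)

lemma ip_x0_x0: "ip x0 x0 \<noteq> 0"
  using ip_definite[OF _ U_in_B, of x0] x0_U d_pos by auto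

text \<open>\<open>Z\<close> commutes with \<open>T\<close>, so applying both to \<open>x0\<close> and using that the values of \<open>T\<close> are multiples
  of \<open>x0\<close> shows that \<open>x0\<close> is an eigenvector of \<open>Z\<close>.\<close>

lemma Z_x0: "Z x0 = (ip (Z x0) x0 / ip x0 x0) \<odot>\<^bsub>M\<^esub> x0"
proof -
  have Zc: "Z x0 \<in> carrier M" by (rule linear_map_closed[OF Z_linear x0_closed])
  have "Z (T x0) = T (Z x0)"
    by (rule twisted_sum_natural[where act = act and act' = act and \<iota> = Z,
          OF M.M.abelian_group_axioms M.M.abelian_group_axioms Z_linear M.act_closed _ M.smult_closed
            fin_V V_G f_K x0_closed])
       (simp_all add: M.conj_trace_act[OF fin T_linear])
  also have "Z (T x0) = (ip x0 x0 / of_nat d) \<odot>\<^bsub>M\<^esub> Z x0"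
    unfolding T_eq(1)[OF x0_closed] using T_eq(2)[OF x0_closed] x0_closed
    by (intro linear_map_smult[OF Z_linear]) (simp_all add: complex_ring_sel)
  also have "T (Z x0) = (ip (Z x0) x0 / of_nat d) \<odot>\<^bsub>M\<^esub> x0" by (rule T_eq(1)[OF Zc])
  finally have eq: "(ip x0 x0 / of_nat d) \<odot>\<^bsub>M\<^esub> Z x0 = (ip (Z x0) x0 / of_nat d) \<odot>\<^bsub>M\<^esub> x0" .
  have quot: "ip (Z x0) x0 / ip x0 x0 \<in> carrier K"
    using F_divide ip_F Zc x0_closed by (simp add: complex_ring_sel)
  show ?thesis
  proof (rule M_eqI[OF Zc M.smult_closed[OF quot x0_closed]])
    fix g assume "g \<in> carrier G"
    then have "ip x0 x0 / of_nat d * Z x0 (U #> g) = ip (Z x0) x0 / of_nat d * x0 (U #> g)"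
      using fun_cong[OF eq, of "U #> g"] by (simp add: smult_apply B_I)
    then show "Z x0 (U #> g) = ((ip (Z x0) x0 / ip x0 x0) \<odot>\<^bsub>M\<^esub> x0) (U #> g)"
      using ip_x0_x0 d_pos \<open>g \<in> carrier G\<close> by (simp add: smult_apply B_I field_simps)
  qed
qed

text \<open>By invariance of the form, each summand of the conjugation trace contributes
  \<open>\<bar>[x0 g\<inverse>, x0]\<bar>\<^sup>2 / d\<close>, and the one for \<open>g = 1\<close> is positive.\<close>

lemma ip_Z_x0: "ip (Z x0) x0 \<noteq> 0"
proof -
  have cl: "act x0 (inv g) \<in> carrier M" "T (act x0 (inv g)) \<in> carrier M"
    "act (T (act x0 (inv g))) g \<in> carrier M" if "g \<in> carrier G" for g
    using that x0_closed by (auto intro!: M.act_closed linear_map_closed[OF T_linear])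
  let ?r = "\<lambda>g. (cmod (ip (act x0 (inv g)) x0))\<^sup>2 / d"
  have "ip (Z x0) x0 = (\<Sum>g\<in>carrier G. ip (act (T (act x0 (inv g))) g) x0)"
    unfolding conj_trace_def by (rule ip_finsum[OF fin cl(3)])
  also have "\<dots> = (\<Sum>g\<in>carrier G. of_real (?r g))"
  proof (rule sum.cong)
    fix g assume g: "g \<in> carrier G"
    let ?y = "act x0 (inv g)"
    have "ip (act (T ?y) g) x0 = ip (T ?y) ?y"
      by (rule ip_act_left[OF g x0_closed])
    also have "\<dots> = ip ?y x0 * cnj (ip ?y x0) / of_nat d"
      by (simp add: T_eq(1)[OF cl(1)[OF g]] ip_smult ip_sym)
    also have "\<dots> = of_real (?r g)"
      by (simp add: complex_norm_square[symmetric])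
    finally show "ip (act (T ?y) g) x0 = of_real (?r g)" .
  qed simp
  finally have eq: "ip (Z x0) x0 = of_real (\<Sum>g\<in>carrier G. ?r g)" by simp
  have "0 < ?r \<one>" using ip_x0_x0 d_pos x0_closed by (simp add: M.act_one)
  then have "0 < (\<Sum>g\<in>carrier G. ?r g)"
    by (intro sum_pos2[OF fin one_closed]) auto
  then show ?thesis unfolding eq of_real_eq_0_iff by linarith
qed

abbreviation "S \<equiv> kg_span K G M act {x0}"
abbreviation "MS \<equiv> M\<lparr>carrier := S\<rparr>"
abbreviation "\<nu> \<equiv> ip (Z x0) x0 / ip x0 x0"

lemma scalar_nonzero: "\<nu> \<in> carrier K" "\<nu> \<noteq> \<zero>\<^bsub>K\<^esub>"
  using F_divide[OF ip_F ip_F] linear_map_closed[OF Z_linear x0_closed] x0_closed ip_x0_x0 ip_Z_x0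
  by (simp_all add: complex_ring_sel)

lemma S_kg_submodule: "kg_submodule K G M act S"
  using x0_closed by (intro M.kg_span_submodule) simp

lemma S_submodule: "submodule S K M"
  using S_kg_submodule by (simp add: kg_submodule_def)

lemma S_closed: "x \<in> S \<Longrightarrow> x \<in> carrier M"
  and S_act: "x \<in> S \<Longrightarrow> g \<in> carrier G \<Longrightarrow> act x g \<in> S"
  using M.submoduleE(1)[OF S_submodule] S_kg_submodule by (auto simp: kg_submodule_def)

lemma x0_S: "x0 \<in> S"
  using kg_span_incl[of "{x0}" K G M act] by simp

text \<open>The eigenspace of \<open>Z\<close> is \<open>G\<close>-stable because \<open>Z\<close> is central.\<close>

lemma Z_S:
  assumes "x \<in> S"
  shows "Z x = \<nu> \<odot>\<^bsub>M\<^esub> x"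
proof -
  have "kg_submodule K G M act {x \<in> carrier M. Z x = \<nu> \<odot>\<^bsub>M\<^esub> x}"
    unfolding kg_submodule_def
  proof (intro conjI ballI M.equalizer_submodule[OF M.module_axioms Z_linear M.linear_map_scale[OF scalar_nonzero(1)]])
    fix x g assume "x \<in> {x \<in> carrier M. Z x = \<nu> \<odot>\<^bsub>M\<^esub> x}" "g \<in> carrier G"
    then show "act x g \<in> {x \<in> carrier M. Z x = \<nu> \<odot>\<^bsub>M\<^esub> x}"
      using M.conj_trace_act[OF fin T_linear, of x g] M.act_smult[OF scalar_nonzero(1), of x g] M.act_closed by simp
  qed
  moreover have "{x0} \<subseteq> {x \<in> carrier M. Z x = \<nu> \<odot>\<^bsub>M\<^esub> x}"
    using x0_closed Z_x0 by simp
  ultimately have "S \<subseteq> {x \<in> carrier M. Z x = \<nu> \<odot>\<^bsub>M\<^esub> x}" by (rule kg_span_least)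
  then show ?thesis using assms by blast
qed

lemma S_perp: "S \<inter> perm_perp K G U (restrict cnj F) S = {\<zero>\<^bsub>M\<^esub>}"
proof (intro equalityI subsetI)
  fix x assume x: "x \<in> S \<inter> perm_perp K G U (restrict cnj F) S"
  then have xM: "x \<in> carrier M" using S_closed by blast
  have "ip x x = 0"
    using x perm_form_eq[OF xM xM] by (simp add: perm_perp_def complex_ring_sel)
  then have "x = \<zero>\<^bsub>M\<^esub>"
    by (intro M_eqI xM M.M.zero_closed)
       (simp add: ip_definite B_I, simp add: perm_module_def free_zero B_I complex_ring_sel)
  then show "x \<in> {\<zero>\<^bsub>M\<^esub>}" by simp
next
  fix x assume "x \<in> {\<zero>\<^bsub>M\<^esub>}"
  then have x: "x = \<zero>\<^bsub>M\<^esub>" by simp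
  have "perm_form K G U (restrict cnj F) \<zero>\<^bsub>M\<^esub> s = \<zero>\<^bsub>K\<^esub>" if "s \<in> S" for s
    unfolding perm_form_eq[OF M.M.zero_closed S_closed[OF that]]
    by (simp add: ip_def perm_module_def free_zero complex_ring_sel)
  moreover have "\<zero>\<^bsub>M\<^esub> \<in> S" using subgroup.one_closed[OF submodule.axioms(1)[OF S_submodule]] by simp
  ultimately show "x \<in> S \<inter> perm_perp K G U (restrict cnj F) S"
    unfolding x perm_perp_def by simp
qed

sublocale S: kg_module K G MS act
  by (rule M.kg_module_submodule[OF S_kg_submodule])

lemma T_MS: "x \<in> S \<Longrightarrow> twisted_sum MS act V f x = T x"
  unfolding twisted_sum_def module.simps
  using M.finsum_in_submodule[OF S_submodule fin_V, of "\<lambda>v. f v \<odot>\<^bsub>M\<^esub> act x v"] f_K V_sub S_act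
    M.submoduleE(4)[OF S_submodule]
  by (simp add: Pi_iff)

lemma T_S: "x \<in> S \<Longrightarrow> T x \<in> S"
  using T_eq[OF S_closed, of x] M.submoduleE(4)[OF S_submodule _ x0_S] by (simp add: complex_ring_sel)

lemma Z_MS:
  assumes x: "x \<in> S"
  shows "conj_trace G MS act (twisted_sum MS act V f) x = Z x"
proof -
  have c: "act (T (act x (inv g))) g \<in> S" if "g \<in> carrier G" for g
    using that x by (intro S_act T_S) auto
  have "conj_trace G MS act (twisted_sum MS act V f) x = (\<Oplus>\<^bsub>MS\<^esub>g\<in>carrier G. act (T (act x (inv g))) g)"
    unfolding conj_trace_def
    by (rule S.M.finsum_cong') (use c x S_act T_MS in auto)
  also have "\<dots> = Z x"
    unfolding conj_trace_def
    by (rule M.finsum_in_submodule[OF S_submodule fin]) (use c in auto)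
  finally show ?thesis .
qed

lemma S_generated: "kg_span K G MS act {x0} = carrier MS"
proof -
  have x0: "{x0} \<subseteq> carrier MS" using x0_S by simp
  have sub: "kg_submodule K G MS act (kg_span K G MS act {x0})"
    by (rule S.kg_span_submodule[OF x0])
  then have "kg_submodule K G M act (kg_span K G MS act {x0})"
    by (rule M.kg_submodule_of_submodule[OF S_kg_submodule])
  then have "S \<subseteq> kg_span K G MS act {x0}"
    by (rule kg_span_least) (rule kg_span_incl)
  moreover have "kg_span K G MS act {x0} \<subseteq> carrier MS"
    using S.submoduleE(1) sub unfolding kg_submodule_def by blast
  ultimately show ?thesis by simp
qed

lemma x0_nonzero: "x0 \<noteq> \<zero>\<^bsub>M\<^esub>"
  using x0_U d_pos U_in_B by (auto simp: perm_module_def free_zero complex_ring_sel)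

lemma line_S: "x \<in> carrier MS \<Longrightarrow> \<exists>c\<in>carrier K. twisted_sum MS act V f x = c \<odot>\<^bsub>MS\<^esub> x0"
  using T_MS[of x] T_eq[OF S_closed, of x] by (auto simp: complex_ring_sel)

lemma scalar_S: "x \<in> carrier MS \<Longrightarrow> conj_trace G MS act (twisted_sum MS act V f) x = \<nu> \<odot>\<^bsub>MS\<^esub> x"
  using Z_MS[of x] Z_S[of x] by simp

lemma irreducible_S: "irreducible_kg_module K G MS act"
proof (rule S.irreducible_criterion[OF field_K fin V_G f_K _ _ S_generated line_S scalar_nonzero scalar_S])
qed (use x0_S x0_nonzero in simp_all)

text \<open>Pure tensors are compared with functions on the cosets with values in \<open>L\<close>; there \<open>x0\<close> is
  nonzero for the same reason as over \<open>K\<close>.\<close>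

lemma absolutely_irreducible_S: "absolutely_irreducible K G MS act"
  unfolding absolutely_irreducible_def
proof (intro conjI exI irreducible_S)
  define A where "A = {x. (ring.algebraic (ring_of_type_algebra :: complex ring) over F) x}"
  define L where "L = (ring_of_type_algebra :: complex ring)\<lparr>carrier := A\<rparr>"
  have closure: "algebraic_closure L F" and FA: "F \<subseteq> A"
    using algebraic_numbers_closure[OF F] unfolding L_def A_def by auto
  interpret L: field L using closure by (rule algebraic_closure.axioms)
  show "algebraic_closure L (carrier K)" using closure by simp
  show "L\<lparr>carrier := carrier K\<rparr> = K" by (simp add: L_def)
  let ?M' = "free_module L B"
  have M': "module L ?M'" by (rule free_module_module[OF L.is_cring])
  have lin: "linear_map K MS ?M' (\<lambda>x. x)"
    unfolding linear_map_def
  proof (intro conjI ballI funcsetI)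
    fix x assume "x \<in> carrier MS"
    then have "x \<in> B \<rightarrow>\<^sub>E F" using S_closed M_carrier by simp
    then show "x \<in> carrier ?M'" using FA fin_B by (auto simp: free_carrier L_def)
  qed (simp_all add: perm_module_def free_add free_smult L_def)
  show "irreducible_kg_module L G (scalar_ext L K MS) (scalar_ext_act L K G MS act)"
  proof (rule S.scalar_ext_irreducible[OF L.field_axioms _ _ fin V_G f_K _ S_generated line_S scalar_nonzero scalar_S M' lin])
    show "carrier K \<subseteq> carrier L" using FA by (simp add: L_def)
    show "x0 \<noteq> \<zero>\<^bsub>?M'\<^esub>" using x0_U d_pos U_in_B by (auto simp: free_zero L_def complex_ring_sel)
  qed (use x0_S in \<open>simp_all add: L_def\<close>)
qed

lemma james_submodule_eq: "james_submodule K G U V f = S"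
  by (simp add: james_submodule_def Let_def x0_def)

end

theorem mainTheorem2:
  fixes G :: "('g, 's) monoid_scheme" and U V N :: "'g set" and k :: nat
    and F :: "complex set" and f :: "'g \<Rightarrow> complex"
    and K :: "complex ring" and \<alpha> :: "complex \<Rightarrow> complex"
    and M :: "(complex, 'g set \<Rightarrow> complex) module" and S :: "('g set \<Rightarrow> complex) set"
  defines "K \<equiv> (ring_of_type_algebra :: complex ring)\<lparr>carrier := F\<rparr>"
    and "\<alpha> \<equiv> restrict cnj F"
    and "M \<equiv> perm_module K G U"
    and "S \<equiv> james_submodule K G U V f"
  assumes "group G" and "finite (carrier G)"
    and "subfield F (ring_of_type_algebra :: complex ring)"
    and "cnj ` F \<subseteq> F"
    and "james_triple G U V N k"
    and "fits K \<alpha> G V N f"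
  shows "S \<inter> perm_perp K G U \<alpha> S = {\<zero>\<^bsub>M\<^esub>} \<and>
    absolutely_irreducible K G (M\<lparr>carrier := S\<rparr>) (perm_act G U)"
proof -
  interpret james_character G U V N k F f
    using assms(6-10) unfolding K_def \<alpha>_def
    by (intro james_character.intro james_character_axioms.intro) auto
  show ?thesis
    unfolding M_def S_def \<alpha>_def K_def james_submodule_eq
    using S_perp absolutely_irreducible_S by blast
qed

end
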